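(* Let $s\in\mathbb{C}$ with $\operatorname{Re} s>1$ and $s\notin\mathbb{Z}$, let $0<x<2\pi$, and let $y\in\mathbb{R}$. Then $$\sum_{n=1}^\infty\frac{\sin(nx+y)}{n^s}=\frac{(2\pi)^s}{2\,\Gamma(s)\sin\pi s}\left(\cos\left(y-\frac{\pi s}{2}\right)\zeta\left(1-s,\frac{x}{2\pi}\right)-\cos\left(y+\frac{\pi s}{2}\right)\zeta\left(1-s,1-\frac{x}{2\pi}\right)\right)$$ and $$\sum_{n=1}^\infty\frac{\cos(nx+y)}{n^s}=\frac{(2\pi)^s}{2\,\Gamma(s)\sin\pi s}\left(\sin\left(y+\frac{\pi s}{2}\right)\zeta\left(1-s,1-\frac{x}{2\pi}\right)-\sin\left(y-\frac{\pi s}{2}\right)\zeta\left(1-s,\frac{x}{2\pi}\right)\right).$$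
   Context: $\zeta(s,a)$, for $0<a\leqslant 1$, denotes the Hurwitz zeta function, i.e. the analytic continuation in $s$ to $\mathbb{C}\setminus\{1\}$ of $\sum_{n=0}^\infty (n+a)^{-s}$ ($\operatorname{Re}s>1$). $\Gamma$ is the Gamma function. *)

theory Defs
  imports "HOL-Complex_Analysis.Complex_Analysis"
begin

definition is_hurwitz_zeta :: "real \<Rightarrow> (complex \<Rightarrow> complex) \<Rightarrow> bool" where
  "is_hurwitz_zeta a f \<longleftrightarrow>
     f holomorphic_on - {1} \<and>
     (\<forall>s. Re s > 1 \<longrightarrow> (\<lambda>n. (of_nat n + of_real a) powr (- s)) sums f s)"

lemma is_hurwitz_zeta_unique:
  assumes f: "is_hurwitz_zeta a f" and g: "is_hurwitz_zeta a g" and s: "s \<noteq> 1"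
  shows "f s = g s"
proof -
  have eq: "f z = g z" if "Re z > 1" for z
    using f g that sums_unique2 unfolding is_hurwitz_zeta_def by blast
  have hol: "(\<lambda>z. f z - g z) holomorphic_on - {1}"
    using f g unfolding is_hurwitz_zeta_def by (blast intro: holomorphic_on_diff)
  have conn: "connected (- {1 :: complex})"
    by (rule connected_punctured_universe) simp
  have "open {z :: complex. Re z > 1}"
    by (rule open_halfspace_Re_gt)
  then have lim: "(2 :: complex) islimpt {z. Re z > 1}"
    by (intro interior_limit_point) (simp add: interior_open)
  have "f s - g s = 0"
  proof (rule analytic_continuation[OF hol _ conn _ _ lim])
    show "open (- {1 :: complex})" by (rule open_Compl) simp
    show "f z - g z = 0" if "z \<in> {z. Re z > 1}" for z
      using eq that by simp
  qed (use s in auto)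
  then show "f s = g s" by simp
qed

text \<open>By the preceding lemma the choice affects only the value at the pole \<open>s = 1\<close>,
  which is unspecified. Only \<open>0 < a \<le> 1\<close> is meaningful.\<close>
definition hurwitz_zeta :: "complex \<Rightarrow> real \<Rightarrow> complex" where
  "hurwitz_zeta s a = (SOME f. is_hurwitz_zeta a f) s"

end

theory Submission
  imports Defs
begin

text \<open>
  Write \<open>Li s q = \<Sum>n\<ge>1. q ^ n / n powr s\<close>. By Euler's formulas both series are linear combinations of
  \<open>Li s (exp (i x))\<close> and \<open>Li s (exp (-i x))\<close>, and with \<open>a = x / (2 \<pi>)\<close> the theorem is an elementary
  rearrangement of Hurwitz' formula
  \<open>\<zeta>(1 - s, a) = Gamma s / (2 \<pi>)\<^sup>s (exp (-\<pi> i s / 2) Li s (exp (i x)) + exp (\<pi> i s / 2) Li s (exp (-i x)))\<close>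
  for \<open>Re s > 1\<close> (\<open>hurwitz_formula\<close>), used for \<open>a\<close> and for \<open>1 - a\<close>. The formula and the existence of the
  continuation of \<open>\<zeta>(w, a)\<close> are obtained together, by continuing the polylogarithm instead of the zeta
  function.

  On the unit circle away from \<open>1\<close> the oscillation of \<open>q ^ n\<close> makes \<open>Li s q\<close> entire in \<open>s\<close>: repeated
  summation by parts replaces \<open>n powr (-s)\<close> by its finite differences, which decay faster and faster. More
  precisely, \<open>Li s q\<close> has a limit \<open>E s\<close> as \<open>q\<close> tends to such a boundary point from inside the disc, \<open>E\<close>
  is entire, and it is the sum of the series where \<open>Re s > 1\<close> (\<open>polylog_tendsto_boundary\<close>,
  \<open>boundary_polylog_holomorphic\<close>, \<open>boundary_polylog_eq\<close>).

  Far to the left, at \<open>s = 1 - w\<close> with \<open>Re w > 1\<close>, Poisson summation applied to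
  \<open>t powr (w - 1) exp (-\<mu> t)\<close> on the positive half-line gives Lipschitz' formula
  \<open>Li (1 - w) (exp (-\<mu>)) = Gamma w (\<Sum>k\<in>\<int>. (\<mu> + 2 \<pi> i k) powr (-w))\<close> for \<open>Re \<mu> > 0\<close>
  (\<open>lipschitz_formula\<close>). Letting \<open>\<mu>\<close> tend to \<open>-i x\<close>, the left side tends to the boundary value and the terms
  with \<open>k \<le> 0\<close> and \<open>k > 0\<close> assemble into the convergent series for \<open>\<zeta>(w, a)\<close> and \<open>\<zeta>(w, 1 - a)\<close>
  (\<open>boundary_polylog_eq_hurwitz_series\<close>).

  Solving these relations at \<open>exp (i x)\<close> and \<open>exp (-i x)\<close> for \<open>\<zeta>(w, a)\<close> and using the reflection
  formula of the Gamma function expresses the series through entire functions and \<open>Gamma (1 - w)\<close>. That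
  expression continues \<open>\<zeta>(w, a)\<close> to the left (\<open>is_hurwitz_zeta_continuation\<close>), and at \<open>w = 1 - s\<close> with
  \<open>Re s > 1\<close>, where the boundary values are convergent series again, it is Hurwitz' formula.
\<close>

section \<open>Boundary values of the polylogarithm\<close>

lemma holomorphic_on_suminf:
  fixes f :: "nat \<Rightarrow> complex \<Rightarrow> complex"
  assumes "open S" and hol: "\<And>n. f n holomorphic_on S"
    and bound: "\<And>z. z \<in> S \<Longrightarrow> \<exists>d M. d > 0 \<and> cball z d \<subseteq> S \<and> summable M \<and>
                  (\<forall>n. \<forall>w\<in>cball z d. norm (f n w) \<le> M n)"
  shows "(\<lambda>z. \<Sum>n. f n z) holomorphic_on S"
proof (rule holomorphic_uniform_sequence[OF \<open>open S\<close>, where f = "\<lambda>n z. \<Sum>i<n. f i z"])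
  show "(\<lambda>z. \<Sum>i<n. f i z) holomorphic_on S" for n
    by (intro holomorphic_intros hol)
  fix z assume "z \<in> S"
  from bound[OF this] obtain d M where "d > 0" "cball z d \<subseteq> S" "summable M"
    and le: "\<And>n w. w \<in> cball z d \<Longrightarrow> norm (f n w) \<le> M n" by blast
  then show "\<exists>d>0. cball z d \<subseteq> S \<and>
      uniform_limit (cball z d) (\<lambda>n z. \<Sum>i<n. f i z) (\<lambda>z. \<Sum>n. f n z) sequentially"
    by (intro exI[of _ d] conjI Weierstrass_m_test[of _ _ M]) auto
qed

text \<open>
  The base point is shifted to \<open>t + 1\<close> so that for \<open>t \<ge> 0\<close> no forward difference, of
  whatever order, touches the singularity of the power at the origin.
\<close>

primrec powr_fwd_diff :: "nat \<Rightarrow> complex \<Rightarrow> real \<Rightarrow> complex" where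
  "powr_fwd_diff 0 s t = of_real (t + 1) powr (-s)"
| "powr_fwd_diff (Suc k) s t = powr_fwd_diff k s (t + 1) - powr_fwd_diff k s t"

lemma powr_fwd_diff_holomorphic: "t \<ge> 0 \<Longrightarrow> (\<lambda>s. powr_fwd_diff k s t) holomorphic_on A"
  by (induction k arbitrary: t) (auto intro!: holomorphic_intros)

lemma powr_fwd_diff_has_vector_derivative:
  "t \<ge> 0 \<Longrightarrow> (powr_fwd_diff k s has_vector_derivative - s * powr_fwd_diff k (s + 1) t) (at t within A)"
proof (induction k arbitrary: t A)
  case 0
  have "((\<lambda>z. (z + 1) powr (-s)) has_field_derivative - s * (of_real t + 1) powr (- (s + 1)))
          (at (of_real t))"
    using 0 by (auto intro!: derivative_eq_intros simp: complex_nonpos_Reals_iff)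
  from has_vector_derivative_real_field[OF this]
  show ?case by simp
next
  case (Suc k)
  have "((\<lambda>t. powr_fwd_diff k s (t + 1)) has_vector_derivative
          1 *\<^sub>R (- s * powr_fwd_diff k (s + 1) (t + 1))) (at t within A)"
    by (rule vector_diff_chain_within[of "\<lambda>t. t + 1", unfolded o_def])
       (use Suc in \<open>auto intro!: derivative_eq_intros simp: has_vector_derivative_at_within\<close>)
  from has_vector_derivative_diff[OF this Suc.IH[OF Suc.prems]]
  show ?case by (simp add: algebra_simps)
qed

text \<open>
  A difference is bounded by a derivative (mean value inequality), and differentiating
  \<open>u powr (-s)\<close> gives \<open>-s\<close> times the same function with exponent parameter \<open>s + 1\<close>. So every
  further difference gains one power of decay; this gain is what carries convergence from
  \<open>Re s > 1\<close> to \<open>Re s > 1 - k\<close>. The quantity \<open>Re s + k\<close> is constant along the induction, which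
  is why a single sign condition on it suffices.
\<close>

lemma norm_powr_fwd_diff_le:
  assumes "t \<ge> 0" "Re s + k \<ge> 0"
  shows "norm (powr_fwd_diff k s t) \<le> norm (pochhammer s k) * (t + 1) powr (-(Re s + k))"
  using assms
proof (induction k arbitrary: s t)
  case 0
  then show ?case by (simp add: norm_powr_real_powr del: of_real_add)
next
  case (Suc k)
  let ?B = "norm s * (norm (pochhammer (s + 1) k) * (t + 1) powr (-(Re s + Suc k)))"
  have "norm (powr_fwd_diff k s (t + 1) - powr_fwd_diff k s t) \<le> ?B * norm (t + 1 - t)"
  proof (rule differentiable_bound[where S = "{t..t+1}"
            and f' = "\<lambda>u h. h *\<^sub>R (- s * powr_fwd_diff k (s + 1) u)"])
    fix u assume u: "u \<in> {t..t+1}"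
    then have "u \<ge> 0" using Suc.prems by simp
    then show "(powr_fwd_diff k s has_derivative (\<lambda>h. h *\<^sub>R (- s * powr_fwd_diff k (s + 1) u)))
                 (at u within {t..t+1})"
      using powr_fwd_diff_has_vector_derivative by (simp add: has_vector_derivative_def)
    have "norm (powr_fwd_diff k (s + 1) u)
          \<le> norm (pochhammer (s + 1) k) * (u + 1) powr (-(Re (s + 1) + k))"
      using Suc.prems \<open>u \<ge> 0\<close> by (intro Suc.IH) auto
    also have "\<dots> \<le> norm (pochhammer (s + 1) k) * (t + 1) powr (-(Re (s + 1) + k))"
      using Suc.prems u by (intro mult_left_mono powr_mono2') auto
    finally have le: "norm (- s * powr_fwd_diff k (s + 1) u) \<le> ?B"
      by (auto simp: norm_mult add_ac intro!: mult_left_mono)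
    show "onorm (\<lambda>h. h *\<^sub>R (- s * powr_fwd_diff k (s + 1) u)) \<le> ?B"
    proof (rule onorm_le)
      show "norm (h *\<^sub>R (- s * powr_fwd_diff k (s + 1) u)) \<le> ?B * norm h" for h :: real
        using mult_left_mono[OF le, of "norm h"] by (simp add: mult_ac)
    qed
  qed auto
  then show ?case by (simp add: pochhammer_rec norm_mult mult.assoc)
qed

lemma summable_powr_fwd_diff:
  assumes "norm q < 1"
  shows "summable (\<lambda>n. powr_fwd_diff k s (real n) * q ^ n)"
proof (induction k)
  case 0
  obtain r where r: "norm q < r" "r < 1" using dense assms by blast
  then have "r > 0" using norm_ge_zero[of q] by linarith
  obtain p where p: "norm q < p" "p < r" "p > 0"
    using dense[OF r(1)] norm_ge_zero[of q] by (metis order_le_less_trans)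
  define c where "c = -Re s"
  \<comment> \<open>\<open>exp d = r / p > 1\<close>, so \<open>(r / p) ^ n\<close> absorbs the power of \<open>n + 1\<close>.\<close>
  define d where "d = ln r - ln p"
  have "d > 0" using p \<open>r > 0\<close> by (simp add: d_def)
  have "(\<lambda>n. (real n + 1) powr c * exp (-d) ^ n) \<longlonglongrightarrow> 0"
    using \<open>d > 0\<close> unfolding exp_of_nat_mult[symmetric] by real_asymp
  then have "eventually (\<lambda>n. (real n + 1) powr c * exp (-d) ^ n < 1) sequentially"
    by (rule order_tendstoD) simp
  then have "eventually (\<lambda>n. norm (powr_fwd_diff 0 s (real n) * q ^ n) \<le> r ^ n) sequentially"
  proof eventually_elim
    case (elim n)
    have "norm (powr_fwd_diff 0 s (real n) * q ^ n) = (real n + 1) powr c * norm q ^ n"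
      by (simp add: norm_mult norm_power norm_powr_real_powr c_def del: of_real_add)
    also have "\<dots> \<le> (real n + 1) powr c * p ^ n"
      using p by (intro mult_left_mono power_mono) auto
    also have "p = exp (-d) * r"
      using p \<open>r > 0\<close> by (simp add: d_def exp_diff)
    also have "(exp (-d) * r) ^ n = exp (-d) ^ n * r ^ n" by (rule power_mult_distrib)
    also have "(real n + 1) powr c * \<dots> \<le> 1 * r ^ n"
      using elim \<open>r > 0\<close> unfolding mult.assoc[symmetric] by (intro mult_right_mono) auto
    finally show ?case by simp
  qed
  moreover have "summable (\<lambda>n. r ^ n)" using r \<open>r > 0\<close> by (simp add: summable_geometric)
  ultimately show ?case by (rule summable_comparison_test_ev)
next
  case (Suc k)
  have *: "summable (\<lambda>n. powr_fwd_diff k s (real (Suc n)) * q ^ n)"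
  proof (cases "q = 0")
    case False
    have "summable (\<lambda>n. inverse q * (powr_fwd_diff k s (real (Suc n)) * q ^ Suc n))"
      using Suc by (intro summable_mult) (subst summable_Suc_iff)
    then show ?thesis using False by (simp add: field_simps)
  qed simp
  have "summable (\<lambda>n. powr_fwd_diff k s (real (Suc n)) * q ^ n - powr_fwd_diff k s (real n) * q ^ n)"
    using * Suc by (rule summable_diff)
  then show ?case by (simp add: algebra_simps)
qed

text \<open>
  Summation by parts. The price for the better decay on the right is the factor
  \<open>1 / (1 - q)\<close>, which is harmless as \<open>q\<close> tends to any point of the unit circle but \<open>1\<close>.
\<close>

lemma suminf_powr_fwd_diff_Suc:
  assumes "norm q < 1"
  shows "(\<Sum>n. powr_fwd_diff k s (real n) * q ^ n) =
         (powr_fwd_diff k s 0 + q * (\<Sum>n. powr_fwd_diff (Suc k) s (real n) * q ^ n)) / (1 - q)"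
proof -
  define f where "f = (\<lambda>n. powr_fwd_diff k s (real n) * q ^ n)"
  have f: "summable f" unfolding f_def by (rule summable_powr_fwd_diff) fact
  have "suminf f - f 0 = (\<Sum>n. f (Suc n))"
    using suminf_split_head[OF f] by simp
  then have "suminf f - f 0 - q * suminf f = (\<Sum>n. f (Suc n) - q * f n)"
    using suminf_diff[of "\<lambda>n. f (Suc n)" "\<lambda>n. q * f n"] f
    by (simp add: summable_mult suminf_mult summable_Suc_iff)
  also have "(\<lambda>n. f (Suc n) - q * f n) = (\<lambda>n. q * (powr_fwd_diff (Suc k) s (real n) * q ^ n))"
    by (simp add: f_def fun_eq_iff algebra_simps)
  also have "suminf \<dots> = q * (\<Sum>n. powr_fwd_diff (Suc k) s (real n) * q ^ n)"
    by (intro suminf_mult summable_powr_fwd_diff assms)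
  finally have "(1 - q) * suminf f = f 0 + q * (\<Sum>n. powr_fwd_diff (Suc k) s (real n) * q ^ n)"
    by (simp add: algebra_simps)
  moreover have "q \<noteq> 1" using assms by auto
  ultimately show ?thesis by (simp add: f_def field_simps)
qed

lemma summable_Suc_powr: "c > 1 \<Longrightarrow> summable (\<lambda>n. (real n + 1) powr (- c))"
  using summable_Suc_iff[of "\<lambda>n. real n powr (- c)"] summable_real_powr_iff[of "-c"]
  by (simp add: add.commute)

lemma powr_fwd_diff_series_continuous:
  assumes "Re s + k > 1"
  shows "continuous_on (cball 0 1) (\<lambda>q. \<Sum>n. powr_fwd_diff k s (real n) * q ^ n)"
proof (rule uniform_limit_theorem)
  show "uniform_limit (cball 0 1) (\<lambda>m q. \<Sum>n<m. powr_fwd_diff k s (real n) * q ^ n)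
          (\<lambda>q. \<Sum>n. powr_fwd_diff k s (real n) * q ^ n) sequentially"
  proof (rule Weierstrass_m_test)
    show "summable (\<lambda>n. norm (pochhammer s k) * (real n + 1) powr (-(Re s + k)))"
      using assms by (intro summable_mult summable_Suc_powr) simp
    fix n q assume "q \<in> cball (0::complex) 1"
    then have "norm (powr_fwd_diff k s (real n) * q ^ n) \<le> norm (powr_fwd_diff k s (real n)) * 1"
      unfolding norm_mult norm_power by (intro mult_left_mono power_le_one) auto
    also have "\<dots> \<le> norm (pochhammer s k) * (real n + 1) powr (-(Re s + k))"
      using norm_powr_fwd_diff_le[of "real n" s k] assms by simp
    finally show "norm (powr_fwd_diff k s (real n) * q ^ n)
        \<le> norm (pochhammer s k) * (real n + 1) powr (-(Re s + k))" .
  qed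
qed (auto intro!: always_eventually continuous_intros)

lemma powr_fwd_diff_series_holomorphic:
  assumes "norm z \<le> 1"
  shows "(\<lambda>s. \<Sum>n. powr_fwd_diff k s (real n) * z ^ n) holomorphic_on {s. Re s > 1 - real k}"
proof (rule holomorphic_on_suminf)
  show op: "open {s. Re s > 1 - real k}" by (rule open_halfspace_Re_gt)
  show "(\<lambda>s. powr_fwd_diff k s (real n) * z ^ n) holomorphic_on {s. Re s > 1 - real k}" for n
    by (intro holomorphic_intros powr_fwd_diff_holomorphic) simp
  fix s assume "s \<in> {s. Re s > 1 - real k}"
  then have s: "Re s > 1 - real k" by simp
  define d where "d = (Re s + k - 1) / 2"
  have "d > 0" using s by (simp add: d_def)
  have Re: "Re u \<ge> Re s - d" if "u \<in> cball s d" for u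
    using that abs_Re_le_cmod[of "s - u"] by (simp add: dist_norm)
  have gt: "Re s - d > 1 - real k" using s by (simp add: d_def field_simps)
  have "compact ((\<lambda>u. pochhammer u k) ` cball s d)"
    unfolding pochhammer_prod by (intro compact_continuous_image continuous_intros) auto
  then have "bounded ((\<lambda>u. pochhammer u k) ` cball s d)" by (rule compact_imp_bounded)
  then obtain C where "\<forall>v\<in>(\<lambda>u. pochhammer u k) ` cball s d. norm v \<le> C"
    unfolding bounded_iff by (rule exE)
  then have C: "norm (pochhammer u k) \<le> C" if "u \<in> cball s d" for u
    using that by simp
  have "C \<ge> 0" using order_trans[OF norm_ge_zero C[of s]] \<open>d > 0\<close> by simp
  define M where "M = (\<lambda>n. C * (real n + 1) powr (-(Re s - d + k)))"
  have "summable M" unfolding M_def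
    using gt by (intro summable_mult summable_Suc_powr) simp
  moreover have "norm (powr_fwd_diff k u (real n) * z ^ n) \<le> M n" if u: "u \<in> cball s d" for n u
  proof -
    have "norm (powr_fwd_diff k u (real n) * z ^ n) \<le> norm (powr_fwd_diff k u (real n)) * 1"
      unfolding norm_mult norm_power using assms by (intro mult_left_mono power_le_one) auto
    also have "\<dots> \<le> norm (pochhammer u k) * (real n + 1) powr (-(Re u + k))"
      using norm_powr_fwd_diff_le[of "real n" u k] Re[OF u] gt by simp
    also have "\<dots> \<le> M n" unfolding M_def
      using C[OF u] Re[OF u] \<open>C \<ge> 0\<close> by (intro mult_mono powr_mono) auto
    finally show ?thesis .
  qed
  moreover have "cball s d \<subseteq> {s. Re s > 1 - real k}"
    using Re gt by force
  ultimately show "\<exists>d M. d > 0 \<and> cball s d \<subseteq> {s. Re s > 1 - real k} \<and> summable M \<and>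
                  (\<forall>n. \<forall>u\<in>cball s d. norm (powr_fwd_diff k u (real n) * z ^ n) \<le> M n)"
    using \<open>d > 0\<close> by blast
qed

text \<open>
  \<open>m\<close> counts the summations by parts still to be done. With none left the series converges
  absolutely on the closed disc; each one widens the half-plane for the undifferenced series
  by one and preserves both the boundary limit and its holomorphy in \<open>s\<close>.
\<close>

lemma boundary_limit_powr_fwd_diff_series:
  assumes z: "norm z = 1" "z \<noteq> 1"
  shows "\<exists>B. B holomorphic_on {s. Re s > 1 - (real k + real m)} \<and>
             (\<forall>s. Re s > 1 - (real k + real m) \<longrightarrow>
                ((\<lambda>q. \<Sum>n. powr_fwd_diff k s (real n) * q ^ n) \<longlongrightarrow> B s) (at z within ball 0 1))"
proof (induction m arbitrary: k)
  case 0
  show ?case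
  proof (intro exI conjI allI impI)
    show "(\<lambda>s. \<Sum>n. powr_fwd_diff k s (real n) * z ^ n)
            holomorphic_on {s. Re s > 1 - (real k + real 0)}"
      using powr_fwd_diff_series_holomorphic[of z k] z by simp
    fix s assume "Re s > 1 - (real k + real 0)"
    then have "continuous_on (cball 0 1) (\<lambda>q. \<Sum>n. powr_fwd_diff k s (real n) * q ^ n)"
      by (intro powr_fwd_diff_series_continuous) simp
    then have "((\<lambda>q. \<Sum>n. powr_fwd_diff k s (real n) * q ^ n) \<longlongrightarrow>
                (\<Sum>n. powr_fwd_diff k s (real n) * z ^ n)) (at z within cball 0 1)"
      using z unfolding continuous_on_def by auto
    then show "((\<lambda>q. \<Sum>n. powr_fwd_diff k s (real n) * q ^ n) \<longlongrightarrow>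
                (\<Sum>n. powr_fwd_diff k s (real n) * z ^ n)) (at z within ball 0 1)"
      by (rule tendsto_within_subset) auto
  qed
next
  case (Suc m)
  let ?H = "{s. Re s > 1 - (real k + real (Suc m))}"
  from Suc[of "Suc k"] obtain B where hol: "B holomorphic_on ?H"
    and lim: "\<And>s. s \<in> ?H \<Longrightarrow> ((\<lambda>q. \<Sum>n. powr_fwd_diff (Suc k) s (real n) * q ^ n) \<longlongrightarrow> B s)
                (at z within ball 0 1)"
    by (auto simp: algebra_simps)
  show ?case
  proof (intro exI conjI allI impI)
    show "(\<lambda>s. (powr_fwd_diff k s 0 + z * B s) / (1 - z)) holomorphic_on ?H"
      using z by (intro holomorphic_intros hol powr_fwd_diff_holomorphic) auto
    fix s assume "Re s > 1 - (real k + real (Suc m))"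
    then have "((\<lambda>q. (powr_fwd_diff k s 0 + q * (\<Sum>n. powr_fwd_diff (Suc k) s (real n) * q ^ n)) / (1 - q))
            \<longlongrightarrow> (powr_fwd_diff k s 0 + z * B s) / (1 - z)) (at z within ball 0 1)"
      using z by (intro tendsto_intros lim) auto
    moreover have "eventually (\<lambda>q. (powr_fwd_diff k s 0 +
          q * (\<Sum>n. powr_fwd_diff (Suc k) s (real n) * q ^ n)) / (1 - q) =
          (\<Sum>n. powr_fwd_diff k s (real n) * q ^ n)) (at z within ball 0 1)"
      unfolding eventually_at_filter
      by (intro always_eventually) (auto simp: suminf_powr_fwd_diff_Suc)
    ultimately show "((\<lambda>q. \<Sum>n. powr_fwd_diff k s (real n) * q ^ n) \<longlongrightarrow>
            (powr_fwd_diff k s 0 + z * B s) / (1 - z)) (at z within ball 0 1)"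
      by (rule Lim_transform_eventually)
  qed
qed

definition polylog :: "complex \<Rightarrow> complex \<Rightarrow> complex" where
  "polylog s q = (\<Sum>n. of_nat (Suc n) powr (-s) * q ^ Suc n)"

lemma polylog_eq_powr_fwd_diff_series:
  assumes "norm q < 1 \<or> norm q \<le> 1 \<and> Re s > 1"
  shows "polylog s q = q * (\<Sum>n. powr_fwd_diff 0 s (real n) * q ^ n)"
proof -
  have "summable (\<lambda>n. powr_fwd_diff 0 s (real n) * q ^ n)"
  proof (cases "norm q < 1")
    case False
    with assms have "norm q \<le> 1" "Re s > 1" by auto
    show ?thesis
    proof (rule summable_comparison_test[OF _ summable_Suc_powr[of "Re s"]], intro exI allI impI)
      fix n :: nat
      have "norm (powr_fwd_diff 0 s (real n) * q ^ n) \<le> norm (powr_fwd_diff 0 s (real n)) * 1"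
        unfolding norm_mult norm_power using \<open>norm q \<le> 1\<close> 
        by (intro mult_left_mono power_le_one) auto
      also have "\<dots> \<le> (real n + 1) powr - Re s"
        by (simp add: norm_powr_real_powr del: of_real_add)
      finally show "norm (powr_fwd_diff 0 s (real n) * q ^ n) \<le> (real n + 1) powr - Re s" .
    qed fact
  qed (rule summable_powr_fwd_diff)
  from suminf_mult[OF this, of q]
  show ?thesis by (simp add: polylog_def mult_ac add.commute)
qed

text \<open>
  Taking the limit from inside the disc gives a value for every \<open>s\<close>, also where the series
  at \<open>z\<close> itself diverges. A limit does not depend on the number of summations by parts
  used to establish it, so the functions found on the various half-planes agree and this one
  function is entire in \<open>s\<close>.
\<close>

definition boundary_polylog :: "complex \<Rightarrow> complex \<Rightarrow> complex" where
  "boundary_polylog z s = Lim (at z within ball 0 1) (polylog s)"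

lemma at_within_ball_nontrivial: "norm z = 1 \<Longrightarrow> at z within ball 0 1 \<noteq> (bot :: complex filter)"
  by (simp add: trivial_limit_within islimpt_ball)

lemma
  assumes z: "norm z = 1" "z \<noteq> 1"
  shows polylog_tendsto_boundary:
      "(polylog s \<longlongrightarrow> boundary_polylog z s) (at z within ball 0 1)"
    and boundary_polylog_holomorphic: "boundary_polylog z holomorphic_on A"
proof -
  have *: "\<exists>B. B holomorphic_on {s. Re s > 1 - real m} \<and>
             (\<forall>s. Re s > 1 - real m \<longrightarrow> (polylog s \<longlongrightarrow> B s) (at z within ball 0 1))" for m
  proof -
    from boundary_limit_powr_fwd_diff_series[OF z, of 0 m]
    obtain B where B: "B holomorphic_on {s. Re s > 1 - real m}"
      "\<And>s. Re s > 1 - real m \<Longrightarrow>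
         ((\<lambda>q. \<Sum>n. powr_fwd_diff 0 s (real n) * q ^ n) \<longlongrightarrow> B s) (at z within ball 0 1)" by auto
    show ?thesis
    proof (intro exI conjI allI impI)
      show "(\<lambda>s. z * B s) holomorphic_on {s. Re s > 1 - real m}"
        by (intro holomorphic_intros B)
      fix s assume "Re s > 1 - real m"
      then have "((\<lambda>q. q * (\<Sum>n. powr_fwd_diff 0 s (real n) * q ^ n)) \<longlongrightarrow> z * B s) (at z within ball 0 1)"
        by (intro tendsto_intros B)
      moreover have "eventually (\<lambda>q. q * (\<Sum>n. powr_fwd_diff 0 s (real n) * q ^ n) = polylog s q)
          (at z within ball 0 1)"
        unfolding eventually_at_filter
        by (intro always_eventually) (auto simp: polylog_eq_powr_fwd_diff_series)
      ultimately show "(polylog s \<longlongrightarrow> z * B s) (at z within ball 0 1)"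
        by (rule Lim_transform_eventually)
    qed
  qed
  have ex: "\<exists>m. Re s > 1 - real m" for s
    using reals_Archimedean2[of "1 - Re s"] by (auto simp: algebra_simps)
  have Lim: "boundary_polylog z s = l" if "(polylog s \<longlongrightarrow> l) (at z within ball 0 1)" for s l
    unfolding boundary_polylog_def using that z
    by (intro tendsto_Lim at_within_ball_nontrivial) auto
  show "(polylog s \<longlongrightarrow> boundary_polylog z s) (at z within ball 0 1)"
    using * ex Lim by metis
  have "boundary_polylog z holomorphic_on {s. Re s > 1 - real m}" for m
  proof -
    from *[of m] obtain B where "B holomorphic_on {s. Re s > 1 - real m}"
      "\<And>s. Re s > 1 - real m \<Longrightarrow> (polylog s \<longlongrightarrow> B s) (at z within ball 0 1)" by blast
    then show ?thesis using Lim
      by (subst holomorphic_cong[OF refl, of _ _ B]) auto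
  qed
  then have "boundary_polylog z holomorphic_on (\<Union>m. {s. Re s > 1 - real m})"
    by (intro holomorphic_on_UN_open open_halfspace_Re_gt)
  moreover have "(\<Union>m. {s. Re s > 1 - real m}) = UNIV" using ex by auto
  ultimately show "boundary_polylog z holomorphic_on A"
    using holomorphic_on_subset by auto
qed

lemma boundary_polylog_eq:
  assumes z: "norm z = 1" "z \<noteq> 1" and s: "Re s > 1"
  shows "boundary_polylog z s = polylog s z"
proof -
  have "continuous_on (cball 0 1) (\<lambda>q. q * (\<Sum>n. powr_fwd_diff 0 s (real n) * q ^ n))"
    using s by (intro continuous_intros powr_fwd_diff_series_continuous) simp
  then have "continuous_on (cball 0 1) (polylog s)"
    by (rule continuous_on_eq) (simp add: polylog_eq_powr_fwd_diff_series s)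
  then have "(polylog s \<longlongrightarrow> polylog s z) (at z within cball 0 1)"
    using z unfolding continuous_on_def by auto
  then have "(polylog s \<longlongrightarrow> polylog s z) (at z within ball 0 1)"
    by (rule tendsto_within_subset) auto
  from tendsto_unique[OF at_within_ball_nontrivial[OF z(1)] polylog_tendsto_boundary[OF z] this]
  show ?thesis .
qed

section \<open>Fourier series and Poisson summation on a half-line\<close>

lemma
  fixes f :: "nat \<Rightarrow> real \<Rightarrow> complex"
  assumes cont: "\<And>n. continuous_on {a..b} (f n)"
    and bound: "\<And>n t. t \<in> {a..b} \<Longrightarrow> norm (f n t) \<le> M n" and M: "summable M"
  shows continuous_on_suminf_M: "continuous_on {a..b} (\<lambda>t. \<Sum>n. f n t)"
    and integral_suminf_M: "(\<lambda>n. integral {a..b} (f n)) sums integral {a..b} (\<lambda>t. \<Sum>n. f n t)"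
proof -
  have unif: "uniform_limit {a..b} (\<lambda>n t. \<Sum>i<n. f i t) (\<lambda>t. \<Sum>n. f n t) sequentially"
    using bound M by (rule Weierstrass_m_test)
  have conts: "continuous_on {a..b} (\<lambda>t. \<Sum>i<n. f i t)" for n
    by (intro continuous_intros cont)
  show "continuous_on {a..b} (\<lambda>t. \<Sum>n. f n t)"
    by (rule uniform_limit_theorem[OF _ unif]) (use conts in auto)
  obtain I J where I: "\<And>n. ((\<lambda>t. \<Sum>i<n. f i t) has_integral I n) {a..b}"
    and J: "((\<lambda>t. \<Sum>n. f n t) has_integral J) {a..b}" "I \<longlonglongrightarrow> J"
    using uniform_limit_integral[OF unif conts] by auto
  have "I = (\<lambda>n. \<Sum>i<n. integral {a..b} (f i))"
    using integral_unique[OF I] cont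
    by (simp add: fun_eq_iff integral_sum integrable_continuous_real)
  with J show "(\<lambda>n. integral {a..b} (f n)) sums integral {a..b} (\<lambda>t. \<Sum>n. f n t)"
    unfolding sums_def by (auto simp: integral_unique)
qed

text \<open>
  Wallis' recursion: integrate the derivative of \<open>sin (\<pi> t) cos (\<pi> t) ^ (2 N + 1)\<close>, which
  vanishes at both ends.
\<close>

lemma integral_cos_power_Suc:
  "2 * (real N + 1) * integral {0..1} (\<lambda>t. cos (pi * t) ^ (2 * Suc N)) =
   (2 * real N + 1) * integral {0..1} (\<lambda>t. cos (pi * t) ^ (2 * N))"
proof -
  let ?F = "\<lambda>t. sin (pi * t) * cos (pi * t) ^ (2 * N + 1) / pi"
  let ?f = "\<lambda>t. (2 * (real N + 1)) * cos (pi * t) ^ (2 * Suc N)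
                 - (2 * real N + 1) * cos (pi * t) ^ (2 * N)"
  have "(?F has_real_derivative ?f t) (at t within {0..1})" for t
  proof -
    have "(?F has_real_derivative (cos (pi * t) * cos (pi * t) ^ (2 * N + 1)
             - (2 * N + 1) * (sin (pi * t))\<^sup>2 * cos (pi * t) ^ (2 * N))) (at t within {0..1})"
    proof -
      have 1: "((\<lambda>t. sin (pi * t)) has_real_derivative (pi * cos (pi * t))) (at t within {0..1})"
        by (auto intro!: derivative_eq_intros)
      have 2: "((\<lambda>t. cos (pi * t)) has_real_derivative (- pi * sin (pi * t))) (at t within {0..1})"
        by (auto intro!: derivative_eq_intros)
      show ?thesis
        using DERIV_cdivide[OF DERIV_mult[OF 1 DERIV_power[OF 2, of "2 * N + 1"]], of pi]
        by (rule DERIV_cong) (simp add: field_simps power2_eq_square)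
    qed
    also have "(sin (pi * t))\<^sup>2 = 1 - (cos (pi * t))\<^sup>2" by (rule sin_squared_eq)
    finally show ?thesis by (simp add: algebra_simps power2_eq_square)
  qed
  then have "(?f has_integral (?F 1 - ?F 0)) {0..1}"
    by (intro fundamental_theorem_of_calculus)
       (auto simp: has_real_derivative_iff_has_vector_derivative)
  then have "(?f has_integral 0) {0..1}" by simp
  then have "0 = integral {0..1} ?f" by (simp add: integral_unique)
  also have "\<dots> = 2 * (real N + 1) * integral {0..1} (\<lambda>t. cos (pi * t) ^ (2 * Suc N))
      - (2 * real N + 1) * integral {0..1} (\<lambda>t. cos (pi * t) ^ (2 * N))"
    by (subst integral_diff) (auto intro!: integrable_continuous_real continuous_intros)
  finally show ?thesis by simp
qed

lemma integral_cos_power_pos: "integral {0..1} (\<lambda>t. cos (pi * t) ^ (2 * N)) > 0"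
proof (induction N)
  case (Suc N)
  have "2 * (real N + 1) * integral {0..1} (\<lambda>t. cos (pi * t) ^ (2 * Suc N)) > 0"
    unfolding integral_cos_power_Suc using Suc by simp
  then show ?case by (simp add: zero_less_mult_iff)
qed simp

text \<open>
  The kernel \<open>cos (\<pi> t) ^ (2 N)\<close> is a trigonometric polynomial, hence orthogonal to \<open>\<phi>\<close>, and as
  \<open>N\<close> grows its mass concentrates at \<open>t = 0\<close> and \<open>t = 1\<close>, the same point of the circle.
  Concentration is made quantitative by \<open>|\<phi> t - \<phi> 0| \<le> |\<phi> 0| / 2 + C sin\<^sup>2 (\<pi> t)\<close>, where
  the last term contributes only the fraction \<open>C / (2 N + 2)\<close> of the total mass by Wallis'
  recursion. So \<open>|\<phi> 0|\<close> is at most half of itself.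
\<close>

lemma zero_if_fourier_coefficients_zero:
  fixes \<phi> :: "real \<Rightarrow> complex"
  assumes cont: "continuous_on {0..1} \<phi>" and per: "\<phi> 1 = \<phi> 0"
    and zero: "\<And>k::int. integral {0..1} (\<lambda>t. \<phi> t * cis (2 * pi * k * t)) = 0"
  shows "\<phi> 0 = 0"
proof (rule ccontr)
  assume nz: "\<phi> 0 \<noteq> 0"
  define I where "I = (\<lambda>N. integral {0..1} (\<lambda>t. cos (pi * t) ^ (2 * N)))"
  have I_pos: "I N > 0" for N unfolding I_def by (rule integral_cos_power_pos)
  have ci: "g integrable_on {0..1}" if "continuous_on {0..1} g" for g :: "real \<Rightarrow> 'a::banach"
    using that by (rule integrable_continuous_real)
  note [continuous_intros] = cont
  \<comment> \<open>The kernel has factor \<open>cos\<^sup>2 (\<pi> t) = (cis (2 \<pi> t) + 2 + cis (-2 \<pi> t)) / 4\<close>, which mixes neighbouring frequencies.\<close>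
  have orth: "integral {0..1} (\<lambda>t. \<phi> t * of_real (cos (pi * t) ^ (2 * N)) * cis (2 * pi * k * t)) = 0"
    for N and k :: int
  proof (induction N arbitrary: k)
    case (Suc N)
    have "\<phi> t * of_real (cos (pi * t) ^ (2 * Suc N)) * cis (2 * pi * k * t) =
      (\<phi> t * of_real (cos (pi * t) ^ (2 * N)) * cis (2 * pi * of_int (k + 1) * t) / 4 +
       \<phi> t * of_real (cos (pi * t) ^ (2 * N)) * cis (2 * pi * k * t) / 2) +
       \<phi> t * of_real (cos (pi * t) ^ (2 * N)) * cis (2 * pi * of_int (k - 1) * t) / 4" for t
    proof -
      have c: "complex_of_real (cos (pi * t)) = (cis (pi * t) + cis (- pi * t)) / 2"
        by (simp add: complex_eq_iff)
      have s: "cis (2 * pi * of_int (k + 1) * t) = cis (pi * t) * cis (pi * t) * cis (2 * pi * k * t)"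
        "cis (2 * pi * of_int (k - 1) * t) = cis (- pi * t) * cis (- pi * t) * cis (2 * pi * k * t)"
        by (simp_all add: cis_mult algebra_simps)
      have one: "cis (pi * t) * cis (- pi * t) = 1" by (simp add: cis_mult)
      have "complex_of_real (cos (pi * t)) ^ 2 = (cis (pi * t) * cis (pi * t) + 
              2 * (cis (pi * t) * cis (- pi * t)) + cis (- pi * t) * cis (- pi * t)) / 4"
        unfolding c by (simp add: power2_eq_square field_simps)
      then have sq: "complex_of_real (cos (pi * t)) ^ 2 = (cis (pi * t) * cis (pi * t) + 
              2 + cis (- pi * t) * cis (- pi * t)) / 4" unfolding one by simp
      have p: "complex_of_real (cos (pi * t) ^ (2 * Suc N)) =
              of_real (cos (pi * t) ^ (2 * N)) * of_real (cos (pi * t)) ^ 2"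
        by (simp add: power2_eq_square)
      show ?thesis unfolding p sq s by (simp add: field_simps)
    qed
    then have "integral {0..1} (\<lambda>t. \<phi> t * of_real (cos (pi * t) ^ (2 * Suc N)) * cis (2 * pi * k * t)) =
      (integral {0..1} (\<lambda>t. \<phi> t * of_real (cos (pi * t) ^ (2 * N)) * cis (2 * pi * of_int (k + 1) * t)) / 4 +
       integral {0..1} (\<lambda>t. \<phi> t * of_real (cos (pi * t) ^ (2 * N)) * cis (2 * pi * k * t)) / 2) +
       integral {0..1} (\<lambda>t. \<phi> t * of_real (cos (pi * t) ^ (2 * N)) * cis (2 * pi * of_int (k - 1) * t)) / 4"
      by (simp only: integral_add integral_divide ci continuous_intros)
         (subst integral_add integral_divide, (intro ci continuous_intros; simp)+, simp)+
    then show ?case by (simp only: Suc.IH) simp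
  qed (use zero in simp)
  obtain d where d: "d > 0" "d < 1/2"
    and near: "\<And>t. t \<in> {0..1} \<Longrightarrow> t < d \<or> t > 1 - d \<Longrightarrow> norm (\<phi> t - \<phi> 0) \<le> norm (\<phi> 0) / 2"
  proof -
    obtain d0 where d0: "d0 > 0" "\<And>t. t \<in> {0..1} \<Longrightarrow> dist t 0 < d0 \<Longrightarrow> dist (\<phi> t) (\<phi> 0) < norm (\<phi> 0) / 2"
      using cont[unfolded continuous_on_iff, rule_format, of 0 "norm (\<phi> 0) / 2"] nz by auto
    obtain d1 where d1: "d1 > 0" "\<And>t. t \<in> {0..1} \<Longrightarrow> dist t 1 < d1 \<Longrightarrow> dist (\<phi> t) (\<phi> 1) < norm (\<phi> 0) / 2"
      using cont[unfolded continuous_on_iff, rule_format, of 1 "norm (\<phi> 0) / 2"] nz by auto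
    show ?thesis
    proof (rule that[of "min (1/3) (min d0 d1)"])
      fix t :: real assume t: "t \<in> {0..1}" "t < min (1/3) (min d0 d1) \<or> t > 1 - min (1/3) (min d0 d1)"
      show "norm (\<phi> t - \<phi> 0) \<le> norm (\<phi> 0) / 2"
      proof (cases "t < min (1/3) (min d0 d1)")
        case True
        then show ?thesis using d0(2)[of t] t by (simp add: dist_norm)
      next
        case False
        then have "1 - t < min (1/3) (min d0 d1)" using t by auto
        then have "dist t 1 < d1" using t by (simp add: dist_real_def)
        then show ?thesis using d1(2)[of t] t per by (simp add: dist_norm)
      qed
    qed (use d0 d1 in auto)
  qed
  have sd: "sin (pi * d) > 0" using d by (intro sin_gt_zero) auto
  have "compact ((\<lambda>t. \<phi> t - \<phi> 0) ` {0..1})"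
    by (intro compact_continuous_image continuous_intros) auto
  then have "bounded ((\<lambda>t. \<phi> t - \<phi> 0) ` {0..1})" by (rule compact_imp_bounded)
  then obtain M where "\<forall>v\<in>(\<lambda>t. \<phi> t - \<phi> 0) ` {0..1}. norm v \<le> M"
    unfolding bounded_iff by (rule exE)
  then have M: "norm (\<phi> t - \<phi> 0) \<le> M" if "t \<in> {0..1}" for t
    using that by simp
  have "M \<ge> 0" using M[of 0] by simp
  define C where "C = M / (sin (pi * d))\<^sup>2"
  have "C \<ge> 0" using \<open>M \<ge> 0\<close> by (simp add: C_def)
  have bound: "norm (\<phi> t - \<phi> 0) \<le> norm (\<phi> 0) / 2 + C * (1 - (cos (pi * t))\<^sup>2)" if t: "t \<in> {0..1}" for t
  proof (cases "t < d \<or> t > 1 - d")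
    case True
    have "1 - (cos (pi * t))\<^sup>2 \<ge> 0" by (metis sin_squared_eq zero_le_power2)
    then have "C * (1 - (cos (pi * t))\<^sup>2) \<ge> 0" using \<open>C \<ge> 0\<close> by simp
    then show ?thesis using near[OF t True] by linarith
  next
    case False
    have "sin (pi * d) \<le> sin (pi * t)"
    proof (cases "t \<le> 1/2")
      case True
      have "pi * d \<le> pi * t" using False by simp
      moreover have "pi * t \<le> pi / 2" using True by simp
      moreover have "0 \<le> pi * d" using d by simp
      ultimately show ?thesis by (intro sin_monotone_2pi_le) (use pi_gt_zero in linarith)+
    next
      case t2: False
      have "pi * d \<le> pi * (1 - t)" using False by simp
      moreover have "pi * (1 - t) \<le> pi * (1 / 2)" by (intro mult_left_mono) (use t2 in auto)
      moreover have "0 \<le> pi * d" using d by simp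
      ultimately have "sin (pi * d) \<le> sin (pi * (1 - t))" by (intro sin_monotone_2pi_le) (use pi_gt_zero in linarith)+
      also have "pi * (1 - t) = pi - pi * t" by (simp add: algebra_simps)
      finally show ?thesis by simp
    qed
    then have "(sin (pi * d))\<^sup>2 \<le> (sin (pi * t))\<^sup>2" using sd by (intro power_mono) auto
    then have "C * (sin (pi * d))\<^sup>2 \<le> C * (sin (pi * t))\<^sup>2" using \<open>C \<ge> 0\<close> by (rule mult_left_mono)
    moreover have "C * (sin (pi * d))\<^sup>2 = M" using sd by (simp add: C_def)
    ultimately have "M \<le> C * (1 - (cos (pi * t))\<^sup>2)" by (simp add: sin_squared_eq)
    then show ?thesis using M[OF t] norm_ge_zero[of "\<phi> 0"] by linarith
  qed
  have main: "norm (\<phi> 0) * I N \<le> norm (\<phi> 0) / 2 * I N + C * (I N - I (Suc N))" for N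
  proof -
    have "\<phi> 0 * of_real (I N) = integral {0..1} (\<lambda>t. \<phi> 0 * of_real (cos (pi * t) ^ (2 * N)))"
    proof -
      have "((\<lambda>t. cos (pi * t) ^ (2 * N)) has_integral I N) {0..1}"
        unfolding I_def by (intro integrable_integral ci continuous_intros)
      from has_integral_mult_right[OF has_integral_of_real[OF this], of "\<phi> 0"]
      show ?thesis by (rule integral_unique[symmetric])
    qed
    also have "\<dots> = integral {0..1} (\<lambda>t. \<phi> 0 * of_real (cos (pi * t) ^ (2 * N)))
                 - integral {0..1} (\<lambda>t. \<phi> t * of_real (cos (pi * t) ^ (2 * N)))"
      using orth[of N 0] by simp
    also have "\<dots> = integral {0..1} (\<lambda>t. \<phi> 0 * of_real (cos (pi * t) ^ (2 * N))
                 - \<phi> t * of_real (cos (pi * t) ^ (2 * N)))"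
      by (rule integral_diff[symmetric]) (auto intro!: ci continuous_intros)
    finally have "norm (\<phi> 0 * of_real (I N)) = norm (integral {0..1} (\<lambda>t. \<phi> 0 * of_real (cos (pi * t) ^ (2 * N))
                 - \<phi> t * of_real (cos (pi * t) ^ (2 * N))))" by (rule arg_cong)
    also have "\<dots> \<le> integral {0..1} (\<lambda>t. norm (\<phi> 0) / 2 * cos (pi * t) ^ (2 * N)
        + C * (cos (pi * t) ^ (2 * N) - cos (pi * t) ^ (2 * Suc N)))"
    proof (rule integral_norm_bound_integral)
      fix t :: real assume t: "t \<in> {0..1}"
      have "norm (\<phi> 0 * of_real (cos (pi * t) ^ (2 * N)) - \<phi> t * of_real (cos (pi * t) ^ (2 * N)))
        = norm (\<phi> t - \<phi> 0) * cos (pi * t) ^ (2 * N)"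
        by (simp flip: left_diff_distrib add: norm_mult norm_power norm_minus_commute)
           (simp add: power_mult)
      also have "\<dots> \<le> (norm (\<phi> 0) / 2 + C * (1 - (cos (pi * t))\<^sup>2)) * cos (pi * t) ^ (2 * N)"
        by (intro mult_right_mono bound t) (simp add: power_mult)
      also have "\<dots> = norm (\<phi> 0) / 2 * cos (pi * t) ^ (2 * N)
        + C * (cos (pi * t) ^ (2 * N) - cos (pi * t) ^ (2 * Suc N))"
        by (simp add: algebra_simps power2_eq_square)
      finally show "norm (\<phi> 0 * of_real (cos (pi * t) ^ (2 * N)) - \<phi> t * of_real (cos (pi * t) ^ (2 * N)))
        \<le> norm (\<phi> 0) / 2 * cos (pi * t) ^ (2 * N)
        + C * (cos (pi * t) ^ (2 * N) - cos (pi * t) ^ (2 * Suc N))" .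
    qed (auto intro!: ci continuous_intros)
    also have "\<dots> = norm (\<phi> 0) / 2 * I N + C * (I N - I (Suc N))"
    proof (rule integral_unique)
      have "((\<lambda>t. cos (pi * t) ^ (2 * N)) has_integral I N) {0..1}" for N
        unfolding I_def by (intro integrable_integral ci continuous_intros)
      then show "((\<lambda>t. norm (\<phi> 0) / 2 * cos (pi * t) ^ (2 * N)
        + C * (cos (pi * t) ^ (2 * N) - cos (pi * t) ^ (2 * Suc N))) has_integral
          (norm (\<phi> 0) / 2 * I N + C * (I N - I (Suc N)))) {0..1}"
        by (intro has_integral_add has_integral_mult_right has_integral_diff)
    qed
    finally show ?thesis using I_pos[of N] by (simp add: norm_mult)
  qed
  have le: "norm (\<phi> 0) / 2 \<le> C / (2 * (real N + 1))" for N
  proof -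
    have "2 * (real N + 1) * I (Suc N) = (2 * real N + 1) * I N"
      unfolding I_def by (rule integral_cos_power_Suc)
    then have eq: "I N - I (Suc N) = I N / (2 * (real N + 1))" by (simp add: field_simps)
    have "norm (\<phi> 0) / 2 * I N \<le> C * (I N - I (Suc N))" using main[of N] by linarith
    then have "norm (\<phi> 0) / 2 * I N \<le> C / (2 * (real N + 1)) * I N" unfolding eq by simp
    then show ?thesis using I_pos[of N] mult_le_cancel_right_pos by blast
  qed
  have "(\<lambda>N. C / (2 * (real N + 1))) \<longlonglongrightarrow> 0" by real_asymp
  then have "norm (\<phi> 0) / 2 \<le> 0"
    by (rule LIMSEQ_le_const) (use le in auto)
  with nz show False by simp
qed

lemma integral_cis_mult_cis:
  fixes k l :: int
  shows "integral {0..1} (\<lambda>t. cis (2 * pi * k * t) * cis (2 * pi * l * t)) = (if k + l = 0 then 1 else 0)"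
proof -
  have eq: "cis (2 * pi * k * t) * cis (2 * pi * l * t) = exp (2 * pi * \<i> * of_int (k + l) * t)" for t :: real
    unfolding cis_mult unfolding cis_conv_exp
    by (rule arg_cong[where f = exp]) (simp add: algebra_simps)
  show ?thesis
  proof (cases "k + l = 0")
    case False
    define c where "c = 2 * pi * \<i> * of_int (k + l)"
    have c: "c \<noteq> 0" using False unfolding c_def by (simp flip: of_int_add)
    have "((\<lambda>t. exp (c * complex_of_real t)) has_integral (exp (c * of_real 1) / c - exp (c * of_real 0) / c)) {0..1}"
    proof (rule fundamental_theorem_of_calculus[where f = "\<lambda>t. exp (c * of_real t) / c"])
      fix t :: real
      have "((\<lambda>z. exp (c * z) / c) has_field_derivative exp (c * t)) (at (of_real t))"
        using c by (auto intro!: derivative_eq_intros)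
      from has_vector_derivative_real_field[OF this]
      show "((\<lambda>t. exp (c * of_real t) / c) has_vector_derivative exp (c * t)) (at t within {0..1})" .
    qed simp
    moreover have "exp c = 1" unfolding c_def exp_eq_1 by (auto intro!: exI[of _ "k + l"])
    ultimately have "integral {0..1} (\<lambda>t. exp (c * complex_of_real t)) = 0" by (simp add: integral_unique)
    then show ?thesis using False unfolding eq c_def by simp
  qed (simp add: eq flip: of_int_add)
qed

text \<open>
  The frequencies \<open>\<nu> j\<close> are left arbitrary so that the positive and the non-positive half of a
  two-sided trigonometric series are both instances.
\<close>

lemma
  fixes a :: "nat \<Rightarrow> complex" and \<nu> :: "nat \<Rightarrow> int"
  assumes a: "summable (\<lambda>j. norm (a j))"
  shows trig_series_continuous: "continuous_on {0..1} (\<lambda>t. \<Sum>j. a j * cis (2 * pi * \<nu> j * t))"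
    and trig_series_coefficient: "integral {0..1} (\<lambda>t. (\<Sum>j. a j * cis (2 * pi * \<nu> j * t)) * cis (2 * pi * l * t))
           = (\<Sum>j. if \<nu> j + l = 0 then a j else 0)"
    and trig_series_periodic: "(\<Sum>j. a j * cis (2 * pi * \<nu> j * 1)) = (\<Sum>j. a j * cis (2 * pi * \<nu> j * 0))"
proof -
  show "continuous_on {0..1} (\<lambda>t. \<Sum>j. a j * cis (2 * pi * \<nu> j * t))"
    by (rule continuous_on_suminf_M[OF _ _ a]) (auto intro!: continuous_intros simp: norm_mult)
  have "(\<lambda>j. integral {0..1} (\<lambda>t. a j * cis (2 * pi * \<nu> j * t) * cis (2 * pi * l * t))) sums
          integral {0..1} (\<lambda>t. \<Sum>j. a j * cis (2 * pi * \<nu> j * t) * cis (2 * pi * l * t))"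
    by (rule integral_suminf_M[OF _ _ a]) (auto intro!: continuous_intros simp: norm_mult)
  also have "(\<lambda>j. integral {0..1} (\<lambda>t. a j * cis (2 * pi * \<nu> j * t) * cis (2 * pi * l * t)))
      = (\<lambda>j. if \<nu> j + l = 0 then a j else 0)"
    by (simp only: mult.assoc integral_mult_right integral_cis_mult_cis[unfolded mult.assoc]) auto
  also have "(\<lambda>t. \<Sum>j. a j * cis (2 * pi * \<nu> j * t) * cis (2 * pi * l * t)) = 
      (\<lambda>t. (\<Sum>j. a j * cis (2 * pi * \<nu> j * t)) * cis (2 * pi * l * t))"
    by (rule ext, rule suminf_mult2[symmetric], rule summable_norm_cancel) (use a in \<open>simp add: norm_mult\<close>)
  finally show "integral {0..1} (\<lambda>t. (\<Sum>j. a j * cis (2 * pi * \<nu> j * t)) * cis (2 * pi * l * t))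
           = (\<Sum>j. if \<nu> j + l = 0 then a j else 0)"
    by (simp add: sums_iff)
  have "cis (2 * pi * \<nu> j * 1) = 1" for j by (simp add: cis_multiple_2pi)
  then show "(\<Sum>j. a j * cis (2 * pi * \<nu> j * 1)) = (\<Sum>j. a j * cis (2 * pi * \<nu> j * 0))" by simp
qed

text \<open>
  The difference of \<open>g\<close> and its absolutely convergent Fourier series is continuous and has
  only zero coefficients, so it vanishes at \<open>0\<close>.
\<close>

lemma fourier_series_at_0:
  fixes g :: "real \<Rightarrow> complex" and c :: "int \<Rightarrow> complex"
  assumes cont: "continuous_on {0..1} g" and per: "g 1 = g 0"
    and coeff: "\<And>k. integral {0..1} (\<lambda>t. g t * cis (- 2 * pi * of_int k * t)) = c k"
    and pos: "summable (\<lambda>j. norm (c (int j + 1)))" and neg: "summable (\<lambda>j. norm (c (- int j)))"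
  shows "g 0 = (\<Sum>j. c (int j + 1)) + (\<Sum>j. c (- int j))"
proof -
  define P where "P = (\<lambda>t. \<Sum>j. c (int j + 1) * cis (2 * pi * of_int (int j + 1) * t))"
  define N where "N = (\<lambda>t. \<Sum>j. c (- int j) * cis (2 * pi * of_int (- int j) * t))"
  note [continuous_intros] = cont trig_series_continuous[OF pos, of "\<lambda>j. int j + 1", folded P_def] 
    trig_series_continuous[OF neg, of "\<lambda>j. - int j", folded N_def]
  have "g 0 - P 0 - N 0 = 0"
  proof (rule zero_if_fourier_coefficients_zero[of "\<lambda>t. g t - P t - N t"])
    show "continuous_on {0..1} (\<lambda>t. g t - P t - N t)" by (intro continuous_intros)
    have "P 1 = P 0" "N 1 = N 0" unfolding P_def N_def
      by (rule trig_series_periodic pos neg)+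
    then show "g 1 - P 1 - N 1 = g 0 - P 0 - N 0" using per by simp
    fix l :: int
    have "integral {0..1} (\<lambda>t. (g t - P t - N t) * cis (2 * pi * l * t)) =
      integral {0..1} (\<lambda>t. g t * cis (2 * pi * l * t)) -
      integral {0..1} (\<lambda>t. P t * cis (2 * pi * l * t)) - integral {0..1} (\<lambda>t. N t * cis (2 * pi * l * t))"
      unfolding left_diff_distrib
      by (subst integral_diff integral_diff, (intro integrable_continuous_real continuous_intros)+)+ simp
    also have "integral {0..1} (\<lambda>t. g t * cis (2 * pi * l * t)) = c (-l)"
      using coeff[of "-l"] by simp
    also have "integral {0..1} (\<lambda>t. P t * cis (2 * pi * l * t)) = (\<Sum>j. if int j + 1 + l = 0 then c (int j + 1) else 0)"
      unfolding P_def by (rule trig_series_coefficient) (rule pos)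
    also have "\<dots> = (if l < 0 then c (- l) else 0)"
    proof (cases "l < 0")
      case True
      have "(\<Sum>j. if int j + 1 + l = 0 then c (int j + 1) else 0) = (\<Sum>j. if j = nat (- l - 1) then c (- l) else 0)"
        using True by (intro suminf_cong) auto
      also have "\<dots> = c (-l)" by (rule sums_unique[symmetric], rule sums_single)
      finally show ?thesis using True by simp
    qed auto
    also have "integral {0..1} (\<lambda>t. N t * cis (2 * pi * l * t)) = (\<Sum>j. if - int j + l = 0 then c (- int j) else 0)"
      unfolding N_def by (rule trig_series_coefficient) (rule neg)
    also have "\<dots> = (if l \<ge> 0 then c (- l) else 0)"
    proof (cases "l \<ge> 0")
      case True
      have "(\<Sum>j. if - int j + l = 0 then c (- int j) else 0) = (\<Sum>j. if j = nat l then c (- l) else 0)"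
        using True by (intro suminf_cong) auto
      also have "\<dots> = c (-l)" by (rule sums_unique[symmetric], rule sums_single)
      finally show ?thesis using True by simp
    qed auto
    finally show "integral {0..1} (\<lambda>t. (g t - P t - N t) * cis (2 * pi * l * t)) = 0" by simp
  qed
  then show ?thesis by (simp add: P_def N_def algebra_simps)
qed

text \<open>
  The periodisation \<open>\<Sum>n. f (t + n)\<close> has the Fourier transform of \<open>f\<close> at the integers as its
  Fourier coefficients. It closes up to a continuous function on the circle because
  \<open>f 0 = 0\<close>: its values at \<open>0\<close> and \<open>1\<close> differ by \<open>f 0\<close>.
\<close>

lemma poisson_summation_half_line:
  fixes f :: "real \<Rightarrow> complex" and c :: "int \<Rightarrow> complex"
  assumes cont: "continuous_on {0..} f" and f0: "f 0 = 0"
    and bound: "\<And>n t. t \<in> {0..1} \<Longrightarrow> norm (f (t + real n)) \<le> M n" and M: "summable M"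
    and coeff: "\<And>k. (\<lambda>n. integral {0..real n} (\<lambda>t. f t * cis (- 2 * pi * of_int k * t))) \<longlonglongrightarrow> c k"
    and pos: "summable (\<lambda>j. norm (c (int j + 1)))" and neg: "summable (\<lambda>j. norm (c (- int j)))"
  shows "(\<Sum>n. f (real (Suc n))) = (\<Sum>j. c (int j + 1)) + (\<Sum>j. c (- int j))"
proof -
  define g where "g = (\<lambda>t. \<Sum>n. f (t + real n))"
  have contn: "continuous_on {0..1} (\<lambda>t. f (t + real n))" for n
    by (rule continuous_on_compose2[OF cont]) (auto intro!: continuous_intros)
  have summ: "summable (\<lambda>n. f (t + real n))" if "t \<in> {0..1}" for t
    by (rule summable_comparison_test'[OF M, of 0]) (rule bound[OF that])
  have "g 0 = (\<Sum>n. f (real (Suc n)))"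
    using suminf_split_head[OF summ[of 0]] f0 unfolding g_def by simp
  moreover have "g 1 = g 0"
    unfolding \<open>g 0 = _\<close> by (simp add: g_def add.commute)
  moreover have "g 0 = (\<Sum>j. c (int j + 1)) + (\<Sum>j. c (- int j))"
  proof (rule fourier_series_at_0)
    show "continuous_on {0..1} g" unfolding g_def
      by (rule continuous_on_suminf_M[OF contn bound M])
    fix k :: int
    define F where "F = (\<lambda>t. f t * cis (- 2 * pi * of_int k * t))"
    have Fcont: "continuous_on {a..b} F" if "a \<ge> 0" for a b
      unfolding F_def using that by (intro continuous_intros continuous_on_subset[OF cont]) auto
    have F: "f (t + real n) * cis (- 2 * pi * of_int k * t) = F (t + real n)" for t n
    proof -
      have "cis (- 2 * pi * of_int k * (t + real n)) = cis (- 2 * pi * of_int k * t) * cis (2 * pi * of_int (- k * int n))"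
        by (simp add: cis_mult algebra_simps)
      also have "cis (2 * pi * of_int (- k * int n)) = 1" by (rule cis_multiple_2pi) auto
      finally show ?thesis by (simp add: F_def)
    qed
    have "(\<lambda>n. integral {0..1} (\<lambda>t. f (t + real n) * cis (- 2 * pi * of_int k * t))) sums
       integral {0..1} (\<lambda>t. \<Sum>n. f (t + real n) * cis (- 2 * pi * of_int k * t))"
      by (rule integral_suminf_M[OF _ _ M]) (auto intro!: continuous_intros contn bound simp: norm_mult)
    also have "integral {0..1} (\<lambda>t. \<Sum>n. f (t + real n) * cis (- 2 * pi * of_int k * t)) =
      integral {0..1} (\<lambda>t. g t * cis (- 2 * pi * of_int k * t))"
      unfolding g_def by (intro integral_cong suminf_mult2[symmetric] summ)
    finally have *: "(\<lambda>n. integral {0..1} (\<lambda>t. F (t + real n))) sums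
        integral {0..1} (\<lambda>t. g t * cis (- 2 * pi * of_int k * t))" unfolding F .
    have "(\<Sum>i<n. integral {0..1} (\<lambda>t. F (t + real i))) = integral {0..real n} F" for n
    proof (induction n)
      case (Suc n)
      have "integral {0..1} (\<lambda>t. F (t + real n)) = integral {real n..real (Suc n)} F"
        using integral_shift_real_ivl[of "real n" "real n" "real (Suc n)" F] by simp
      moreover have "integral {0..real n} F + integral {real n..real (Suc n)} F = integral {0..real (Suc n)} F"
        by (intro Henstock_Kurzweil_Integration.integral_combine integrable_continuous_real Fcont) auto
      ultimately show ?case using Suc by simp
    qed simp
    with * have "(\<lambda>n. integral {0..real n} F) \<longlonglongrightarrow> integral {0..1} (\<lambda>t. g t * cis (- 2 * pi * of_int k * t))"
      unfolding sums_def by simp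
    then show "integral {0..1} (\<lambda>t. g t * cis (- 2 * pi * of_int k * t)) = c k"
      using coeff[of k] unfolding F_def by (rule LIMSEQ_unique)
  qed (use \<open>g 1 = g 0\<close> pos neg in auto)
  ultimately show ?thesis by simp
qed

section \<open>The Gamma integral with complex scale\<close>

lemma Gamma_integral_scaled_real:
  fixes c :: real
  assumes w: "Re w > 0" and c: "c > 0"
  shows "((\<lambda>t. of_real t powr (w - 1) * of_real (exp (- c * t))) has_integral
           Gamma w * of_real c powr (- w)) {0<..}"
proof -
  let ?f = "\<lambda>t. complex_of_real t powr (w - 1) / of_real (exp t)"
  have img: "(\<lambda>t. c * t) ` {0<..} = {0<..}"
    using c by (auto simp: image_iff intro!: bexI[of _ "_ / c"])
  have "?f absolutely_integrable_on {0<..}"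
    by (rule absolutely_integrable_Gamma_integral'[OF w])
  moreover have "integral {0<..} ?f = Gamma w"
    using Gamma_integral_complex'[OF w] by (rule integral_unique)
  ultimately have "(\<lambda>t. \<bar>c\<bar> *\<^sub>R ?f (c * t)) absolutely_integrable_on {0<..} \<and>
      integral {0<..} (\<lambda>t. \<bar>c\<bar> *\<^sub>R ?f (c * t)) = Gamma w"
    using c by (subst has_absolute_integral_change_of_variables_real)
       (auto simp: img inj_on_def intro!: derivative_eq_intros)
  then have "((\<lambda>t. \<bar>c\<bar> *\<^sub>R ?f (c * t)) has_integral Gamma w) {0<..}"
    by (metis has_integral_integral set_lebesgue_integral_eq_integral(1))
  from has_integral_mult_right[OF this, of "of_real c powr (- w)"]
  show ?thesis
  proof (subst mult.commute, rule has_integral_eq[rotated])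
    fix t :: real assume t: "t \<in> {0<..}"
    have "of_real (c * t) powr (w - 1) = of_real c powr (w - 1) * complex_of_real t powr (w - 1)"
      using c t by (simp add: powr_times_real)
    moreover have "of_real c powr (- w) * (of_real c * of_real c powr (w - 1)) = (1 :: complex)"
      using c by (simp add: powr_diff powr_minus)
    ultimately show "of_real c powr (- w) * (\<bar>c\<bar> *\<^sub>R ?f (c * t)) =
        of_real t powr (w - 1) * of_real (exp (- c * t))"
      using c by (simp add: scaleR_conv_of_real exp_minus field_simps)
  qed
qed

text \<open>
  For a real \<open>c\<close> with \<open>|c - \<nu>| < c\<close>, expand
  \<open>exp (-\<nu> t) = exp (-c t) exp ((c - \<nu>) t)\<close> into powers of \<open>c - \<nu>\<close>; each term is a Gamma integral
  with real scale, and the resulting series is the binomial series of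
  \<open>(1 - (c - \<nu>) / c) powr (-w)\<close>. The bound on \<open>c - \<nu>\<close> makes \<open>exp (-(c - |c - \<nu>|) t)\<close> decay, and
  times \<open>t powr (Re w - 1)\<close> it dominates the partial sums.
\<close>

lemma Gamma_integral_scaled_complex:
  assumes w: "Re w > 0" and \<nu>: "Re \<nu> > 0"
  shows "((\<lambda>t. of_real t powr (w - 1) * exp (- \<nu> * of_real t)) has_integral
           Gamma w * \<nu> powr (- w)) {0<..}"
proof -
  \<comment> \<open>\<open>|c - \<nu>|\<^sup>2 = c\<^sup>2 - 2 c Re \<nu> + |\<nu>|\<^sup>2\<close>, so any \<open>c > |\<nu>|\<^sup>2 / (2 Re \<nu>)\<close> will do.\<close>
  define c where "c = (norm \<nu>)\<^sup>2 / Re \<nu>"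
  have "\<nu> \<noteq> 0" using \<nu> by auto
  have c: "c > 0" using \<nu> \<open>\<nu> \<noteq> 0\<close> by (simp add: c_def)
  define d where "d = of_real c - \<nu>"
  have "(norm d)\<^sup>2 = c\<^sup>2 - 2 * c * Re \<nu> + (norm \<nu>)\<^sup>2"
    unfolding cmod_power2 by (simp add: d_def power2_eq_square algebra_simps)
  also have "c\<^sup>2 - 2 * c * Re \<nu> + (norm \<nu>)\<^sup>2 < c\<^sup>2"
  proof -
    have "c * Re \<nu> = (norm \<nu>)\<^sup>2" using \<nu> by (simp add: c_def)
    moreover have "(norm \<nu>)\<^sup>2 > 0" using \<open>\<nu> \<noteq> 0\<close> by simp
    ultimately show ?thesis by linarith
  qed
  finally have d: "norm d < c" using c by (metis less_imp_le power_less_imp_less_base)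
  define b where "b = c - norm d"
  have b: "b > 0" using d by (simp add: b_def)
  define f where "f = (\<lambda>m t. \<Sum>j<m. d ^ j / fact j *
      (of_real t powr (w + of_nat j - 1) * of_real (exp (- c * t))))"
  define I where "I = (\<lambda>m. \<Sum>j<m. d ^ j / fact j *
      (Gamma (w + of_nat j) * of_real c powr (- (w + of_nat j))))"
  show ?thesis
  proof (rule has_integral_dominated_convergence)
    show "(f m has_integral I m) {0<..}" for m
      unfolding f_def I_def using w c
      by (intro has_integral_sum has_integral_mult_right Gamma_integral_scaled_real) auto
    have f_eq: "f m t = of_real t powr (w - 1) * of_real (exp (- c * t)) * (\<Sum>j<m. (d * of_real t) ^ j / fact j)"
      if "t > 0" for m t
    proof -
      have "complex_of_real t powr (w + of_nat j - 1) = of_real t powr (w - 1) * of_real t ^ j" for j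
        using that by (simp add: powr_diff powr_add powr_nat')
      then show ?thesis unfolding f_def sum_distrib_left
        by (intro sum.cong) (auto simp: power_mult_distrib)
    qed
    show "(\<lambda>t. norm (complex_of_real t powr (of_real (Re w) - 1) / of_real (exp (b * t)))) integrable_on {0<..}"
      using absolutely_integrable_Gamma_integral[of "of_real (Re w)" b] w b
      by (simp add: absolutely_integrable_on_def)
    show "\<forall>t\<in>{0<..}. norm (f m t) \<le> norm (complex_of_real t powr (of_real (Re w) - 1) / of_real (exp (b * t)))" for m
    proof
      fix t :: real assume "t \<in> {0<..}"
      then have t: "t > 0" by simp
      have "norm (\<Sum>j<m. (d * of_real t) ^ j / fact j) \<le> (\<Sum>j<m. (norm d * t) ^ j / fact j)"
        by (rule order_trans[OF norm_sum]) (use t in \<open>simp add: norm_divide norm_power norm_mult\<close>)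
      also have "\<dots> \<le> exp (norm d * t)"
      proof -
        have "(\<lambda>j. (norm d * t) ^ j / fact j) sums exp (norm d * t)"
          using exp_converges[of "norm d * t"] by (simp add: field_simps)
        then show ?thesis
          using t sum_le_suminf[of "\<lambda>j. (norm d * t) ^ j / fact j" "{..<m}"] by (simp add: sums_iff)
      qed
      finally have "norm (f m t) \<le> t powr (Re w - 1) * exp (- c * t) * exp (norm d * t)"
        unfolding f_eq[OF t] norm_mult using t
        by (intro mult_mono) (auto simp: norm_powr_real_powr)
      also have "\<dots> = norm (complex_of_real t powr (of_real (Re w) - 1) / of_real (exp (b * t)))"
      proof -
        have "exp (- c * t) * exp (norm d * t) = inverse (exp (b * t))"
          by (simp add: b_def algebra_simps flip: exp_minus exp_add)
        then show ?thesis
          using t by (simp add: norm_mult norm_inverse norm_powr_real_powr divide_inverse mult.assoc)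
      qed
      finally show "norm (f m t) \<le> \<dots>" .
    qed
    show "\<forall>t\<in>{0<..}. (\<lambda>m. f m t) \<longlonglongrightarrow> of_real t powr (w - 1) * exp (- \<nu> * of_real t)"
    proof
      fix t :: real assume "t \<in> {0<..}"
      then have t: "t > 0" by simp
      have "(\<lambda>m. \<Sum>j<m. (d * of_real t) ^ j / fact j) \<longlonglongrightarrow> exp (d * of_real t)"
        using exp_converges[of "d * of_real t"] unfolding sums_def
        by (simp add: scaleR_conv_of_real field_simps)
      then have "(\<lambda>m. f m t) \<longlonglongrightarrow> of_real t powr (w - 1) * of_real (exp (- c * t)) * exp (d * of_real t)"
        unfolding f_eq[OF t] by (intro tendsto_intros)
      moreover have "of_real (exp (- c * t)) * exp (d * of_real t) = exp (- \<nu> * of_real t)"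
        unfolding exp_of_real[symmetric] mult_exp_exp by (simp add: d_def algebra_simps)
      ultimately show "(\<lambda>m. f m t) \<longlonglongrightarrow> of_real t powr (w - 1) * exp (- \<nu> * of_real t)"
        by (simp add: mult.assoc)
    qed
    have "norm (- d / of_real c) < 1" using d c by (simp add: norm_divide)
    from gen_binomial_complex[OF this, of "- w"]
    have "(\<lambda>m. \<Sum>j<m. (- w gchoose j) * (- d / of_real c) ^ j) \<longlonglongrightarrow> (1 + - d / of_real c) powr (- w)"
      unfolding sums_def .
    then have "(\<lambda>m. Gamma w * of_real c powr (- w) * (\<Sum>j<m. (- w gchoose j) * (- d / of_real c) ^ j))
        \<longlonglongrightarrow> Gamma w * of_real c powr (- w) * (1 + - d / of_real c) powr (- w)"
      by (intro tendsto_intros)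
    also have "1 + - d / of_real c = \<nu> / of_real c" using c by (simp add: d_def field_simps)
    also have "Gamma w * of_real c powr (- w) * (\<nu> / of_real c) powr (- w) = Gamma w * \<nu> powr (- w)"
    proof -
      have "\<nu> = of_real c * (\<nu> / of_real c)" using c by simp
      then have "\<nu> powr (- w) = of_real c powr (- w) * (\<nu> / of_real c) powr (- w)"
        using c powr_times_real_left[of "of_real c" "\<nu> / of_real c" "- w"] by simp
      then show ?thesis by simp
    qed
    also have "(\<lambda>m. Gamma w * of_real c powr (- w) * (\<Sum>j<m. (- w gchoose j) * (- d / of_real c) ^ j)) = I"
    proof
      fix m
      have "Gamma w * of_real c powr (- w) * ((- w gchoose j) * (- d / of_real c) ^ j) =
         d ^ j / fact j * (Gamma (w + of_nat j) * of_real c powr (- (w + of_nat j)))" for j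
      proof -
        have "w \<notin> \<int>\<^sub>\<le>\<^sub>0" using w by (auto elim!: nonpos_Ints_cases)
        then have "Gamma (w + of_nat j) = pochhammer w j * Gamma w"
          using pochhammer_Gamma[of w j] by (simp add: Gamma_eq_zero_iff)
        moreover have "of_real c powr (- (w + of_nat j)) = of_real c powr (- w) / complex_of_real c ^ j"
          using c by (simp add: powr_diff powr_nat' )
        moreover have "(- w gchoose j) * (- d / of_real c) ^ j = pochhammer w j / fact j * d ^ j / of_real c ^ j"
        proof -
          have "(- d / of_real c) ^ j = (-1) ^ j * (d ^ j / of_real c ^ j)"
            by (simp add: power_minus[of "d / of_real c" j] power_divide)
          then have "(- w gchoose j) * (- d / of_real c) ^ j =
              ((-1) ^ j * (-1) ^ j) * (pochhammer w j / fact j * d ^ j / of_real c ^ j)"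
            by (simp add: gbinomial_pochhammer)
          also have "(-1) ^ j * (-1) ^ j = (1 :: complex)" by (simp flip: power_mult_distrib)
          finally show ?thesis by simp
        qed
        ultimately show ?thesis by simp
      qed
      then show "Gamma w * of_real c powr (- w) * (\<Sum>j<m. (- w gchoose j) * (- d / of_real c) ^ j) = I m"
        unfolding I_def sum_distrib_left by (intro sum.cong refl)
    qed
    finally show "I \<longlonglongrightarrow> Gamma w * \<nu> powr (- w)" .
  qed
qed

lemma integral_half_line_tendsto:
  fixes f :: "real \<Rightarrow> complex"
  assumes "(f has_integral I) {0<..}"
  shows "(\<lambda>n. integral {0..real n} f) \<longlonglongrightarrow> I"
proof (rule LIMSEQ_I)
  fix e :: real assume "e > 0"
  then obtain B where B: "\<And>a b. ball 0 B \<subseteq> cbox a b \<Longrightarrow>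
      norm (integral (cbox a b) (\<lambda>x. if x \<in> {0<..} then f x else 0) - I) < e"
    using assms unfolding has_integral_alt' by blast
  obtain N :: nat where N: "real N \<ge> B" using real_arch_simple by blast
  show "\<exists>no. \<forall>n\<ge>no. norm (integral {0..real n} f - I) < e"
  proof (intro exI allI impI)
    fix n assume "N \<le> n"
    then have "ball 0 B \<subseteq> cbox (- real n) (real n)" using N by (auto simp: dist_norm)
    from B[OF this]
    have "norm (integral ({0<..} \<inter> {- real n..real n}) f - I) < e"
      by (simp only: cbox_interval integral_restrict_Int)
    also have "integral ({0<..} \<inter> {- real n..real n}) f = integral {0..real n} f"
    proof (rule integral_spike_set)
      show "negligible {x \<in> {0<..} \<inter> {- real n..real n} - {0..real n}. f x \<noteq> 0}"
        by (rule negligible_subset[of "{}"]) auto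
      show "negligible {x \<in> {0..real n} - {0<..} \<inter> {- real n..real n}. f x \<noteq> 0}"
        by (rule negligible_subset[of "{0}"]) auto
    qed
    finally show "norm (integral {0..real n} f - I) < e" .
  qed
qed

section \<open>Lipschitz' formula and the Hurwitz series\<close>

text \<open>
  A bound through the imaginary part alone: it is uniform in the real part, which later
  tends to zero.
\<close>

lemma norm_powr_le_Im:
  assumes "Im z \<noteq> 0" "Re w \<ge> 0" "0 < r" "r \<le> \<bar>Im z\<bar>"
  shows "norm (z powr (- w)) \<le> exp (pi * \<bar>Im w\<bar>) * r powr (- Re w)"
proof -
  have "Im w * Arg z \<le> \<bar>Im w\<bar> * \<bar>Arg z\<bar>" by (metis abs_ge_self abs_mult)
  also have "\<dots> \<le> \<bar>Im w\<bar> * pi"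
    using mpi_less_Arg[of z] Arg_le_pi[of z] by (intro mult_left_mono) auto
  finally have "exp (Im w * Arg z) \<le> exp (pi * \<bar>Im w\<bar>)" by (simp add: mult.commute)
  moreover have "norm z powr (- Re w) \<le> r powr (- Re w)"
    using assms abs_Im_le_cmod[of z] by (intro powr_mono2') auto
  ultimately have "norm z powr (- Re w) * exp (Im w * Arg z) \<le> r powr (- Re w) * exp (pi * \<bar>Im w\<bar>)"
    by (intro mult_mono) auto
  then show ?thesis by (simp add: norm_powr_complex mult.commute)
qed

text \<open>
  Poisson summation for \<open>t powr (w - 1) * exp (-\<mu> t)\<close>, whose Fourier transform is a Gamma integral
  with complex scale. Writing the imaginary part of \<open>\<mu>\<close> as \<open>-2 \<pi> a\<close> with \<open>0 < a < 1\<close> keeps all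
  shifts \<open>\<mu> + 2 \<pi> i k\<close> off the real axis, those with \<open>k > 0\<close> above and the others below it.
\<close>

lemma lipschitz_formula:
  assumes w: "Re w > 1" and \<mu>: "Re \<mu> > 0" and a: "0 < a" "a < 1" and Im: "Im \<mu> = - 2 * pi * a"
  shows "polylog (1 - w) (exp (- \<mu>)) = Gamma w *
           ((\<Sum>j. (\<mu> + 2 * of_real pi * \<i> * of_nat (Suc j)) powr (- w)) +
            (\<Sum>j. (\<mu> - 2 * of_real pi * \<i> * of_nat j) powr (- w)))"
proof -
  define f where "f = (\<lambda>t. of_real t powr (w - 1) * exp (- \<mu> * of_real t))"
  define p where "p = (\<lambda>k::int. (\<mu> + 2 * of_real pi * \<i> * of_int k) powr (- w))"
  define c where "c = (\<lambda>k. Gamma w * p k)"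
  define M where "M = (\<lambda>n. (real n + 1) powr (Re w - 1) * exp (- Re \<mu>) ^ n)"
  have summ: "summable (\<lambda>j. norm (p (k j)))"
    if "0 < b" and k: "\<And>j. b * (real j + 1) \<le> \<bar>Im \<mu> + 2 * pi * of_int (k j)\<bar>" for k b
  proof (rule summable_comparison_test[OF exI])
    show "summable (\<lambda>j. exp (pi * \<bar>Im w\<bar>) * (b powr (- Re w) * (real j + 1) powr (- Re w)))"
      using w by (intro summable_mult summable_Suc_powr)
    show "\<forall>j\<ge>0. norm (norm (p (k j))) \<le> exp (pi * \<bar>Im w\<bar>) * (b powr (- Re w) * (real j + 1) powr (- Re w))"
    proof (intro allI impI)
      fix j :: nat
      have "norm (p (k j)) \<le> exp (pi * \<bar>Im w\<bar>) * (b * (real j + 1)) powr (- Re w)"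
        unfolding p_def
      proof (rule norm_powr_le_Im)
        have "0 < b * (real j + 1)" using \<open>0 < b\<close> by simp
        with k[of j] show "Im (\<mu> + 2 * of_real pi * \<i> * of_int (k j)) \<noteq> 0" by auto
      qed (use k[of j] w \<open>0 < b\<close> in auto)
      then show "norm (norm (p (k j))) \<le> exp (pi * \<bar>Im w\<bar>) * (b powr (- Re w) * (real j + 1) powr (- Re w))"
        using \<open>0 < b\<close> by (simp add: powr_mult)
    qed
  qed
  have pos: "summable (\<lambda>j. norm (p (int j + 1)))"
  proof (rule summ)
    show "0 < 2 * pi * (1 - a)" using a by simp
    fix j :: nat
    have "a * real j \<ge> 0" using a by simp
    then have "(1 - a) * (real j + 1) \<le> real j + 1 - a" by (simp add: algebra_simps)
    then have "2 * pi * ((1 - a) * (real j + 1)) \<le> 2 * pi * (real j + 1 - a)"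
      by (intro mult_left_mono) auto
    also have "\<dots> = Im \<mu> + 2 * pi * of_int (int j + 1)" by (simp add: Im algebra_simps)
    finally show "2 * pi * (1 - a) * (real j + 1) \<le> \<bar>Im \<mu> + 2 * pi * of_int (int j + 1)\<bar>" 
      by (simp add: mult.assoc)
  qed
  have neg: "summable (\<lambda>j. norm (p (- int j)))"
  proof (rule summ)
    show "0 < 2 * pi * a" using a by simp
    fix j :: nat
    have "a * real j \<le> 1 * real j" using a by (intro mult_right_mono) auto
    then have "a * (real j + 1) \<le> real j + a" by (simp add: algebra_simps)
    then have "2 * pi * (a * (real j + 1)) \<le> 2 * pi * (real j + a)"
      by (intro mult_left_mono) auto
    also have "\<dots> = - (Im \<mu> + 2 * pi * of_int (- int j))" by (simp add: Im algebra_simps)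
    finally show "2 * pi * a * (real j + 1) \<le> \<bar>Im \<mu> + 2 * pi * of_int (- int j)\<bar>" 
      by (simp add: mult.assoc)
  qed
  have "polylog (1 - w) (exp (- \<mu>)) = (\<Sum>n. f (real (Suc n)))"
    unfolding polylog_def f_def
    unfolding exp_of_nat_mult[symmetric]
    by (intro suminf_cong) (simp add: mult.commute del: of_nat_Suc)
  also have "\<dots> = (\<Sum>j. c (int j + 1)) + (\<Sum>j. c (- int j))"
  proof (rule poisson_summation_half_line)
    show "continuous_on {0..} f" unfolding f_def
      by (intro continuous_intros continuous_on_powr_complex) (use w in auto)
    show "f 0 = 0" by (simp add: f_def)
    have "summable (\<lambda>n. Re (powr_fwd_diff 0 (of_real (1 - Re w)) (real n) * of_real (exp (- Re \<mu>)) ^ n))"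
      using \<mu> by (intro summable_Re summable_powr_fwd_diff) simp
    also have "(\<lambda>n. Re (powr_fwd_diff 0 (of_real (1 - Re w)) (real n) * of_real (exp (- Re \<mu>)) ^ n)) = M"
    proof
      fix n
      have "powr_fwd_diff 0 (of_real (1 - Re w)) (real n) * of_real (exp (- Re \<mu>)) ^ n = of_real (M n)"
        unfolding M_def powr_fwd_diff.simps of_real_minus[symmetric]
        by (subst powr_of_real) auto
      then show "Re (powr_fwd_diff 0 (of_real (1 - Re w)) (real n) * of_real (exp (- Re \<mu>)) ^ n) = M n"
        by (metis Re_complex_of_real)
    qed
    finally show "summable M" .
    fix n :: nat and t :: real assume t: "t \<in> {0..1}"
    have "norm (f (t + real n)) = (t + real n) powr (Re w - 1) * exp (- Re \<mu> * (t + real n))"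
      using t by (simp add: f_def norm_mult norm_powr_real_powr del: of_real_add)
    also have "\<dots> \<le> (real n + 1) powr (Re w - 1) * exp (real n * (- Re \<mu>))"
      using t w \<mu> by (intro mult_mono powr_mono2) (auto simp: algebra_simps)
    finally show "norm (f (t + real n)) \<le> M n" unfolding M_def exp_of_nat_mult .
  next
    fix k :: int
    have "f t * cis (- 2 * pi * of_int k * t) =
        of_real t powr (w - 1) * exp (- (\<mu> + 2 * of_real pi * \<i> * of_int k) * of_real t)" for t
      unfolding f_def cis_conv_exp mult.assoc mult_exp_exp
      by (simp add: algebra_simps)
    then show "(\<lambda>n. integral {0..real n} (\<lambda>t. f t * cis (- 2 * pi * of_int k * t))) \<longlonglongrightarrow> c k"
      unfolding c_def p_def using w \<mu>
      by (simp only:) (intro integral_half_line_tendsto Gamma_integral_scaled_complex; simp)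
  qed (use pos neg in \<open>simp_all add: c_def norm_mult summable_mult\<close>)
  also have "(\<Sum>j. c (int j + 1)) = Gamma w * (\<Sum>j. p (int j + 1))"
    unfolding c_def by (rule suminf_mult) (rule summable_norm_cancel[OF pos])
  also have "(\<Sum>j. c (- int j)) = Gamma w * (\<Sum>j. p (- int j))"
    unfolding c_def by (rule suminf_mult) (rule summable_norm_cancel[OF neg])
  finally show ?thesis by (simp add: p_def distrib_left add.commute)
qed

definition hurwitz_series :: "real \<Rightarrow> complex \<Rightarrow> complex" where
  "hurwitz_series a w = (\<Sum>n. (of_nat n + of_real a) powr (- w))"

text \<open>
  Since \<open>a \<le> 1\<close>, \<open>n + a \<ge> a (n + 1)\<close>. The two exponents \<open>r\<close> and \<open>R\<close> make the bound uniform for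
  \<open>Re w\<close> in a compact interval.
\<close>

lemma norm_shifted_powr_le:
  assumes a: "0 < a" "a \<le> 1" and r: "1 \<le> r" "r \<le> Re w" "Re w \<le> R"
  shows "norm ((of_nat n + of_real a) powr (- w) :: complex) \<le> a powr (- R) * (real n + 1) powr (- r)"
proof -
  have "of_nat n + of_real a = complex_of_real (real n + a)" by simp
  then have "norm ((of_nat n + of_real a) powr (- w) :: complex) = (real n + a) powr (- Re w)"
    using a by (simp only: norm_powr_real_powr Reals_of_real Re_complex_of_real) 
      (simp add: norm_powr_real_powr del: of_real_add)
  also have "\<dots> \<le> (a * (real n + 1)) powr (- Re w)"
  proof (rule powr_mono2')
    have "a * real n \<le> 1 * real n" using a by (intro mult_right_mono) auto
    then show "a * (real n + 1) \<le> real n + a" by (simp add: algebra_simps)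
  qed (use a r in auto)
  also have "\<dots> = a powr (- Re w) * (real n + 1) powr (- Re w)"
    using a by (simp add: powr_mult)
  also have "\<dots> \<le> a powr (- R) * (real n + 1) powr (- r)"
    using a r by (intro mult_mono powr_mono' powr_mono) auto
  finally show ?thesis .
qed

lemma
  assumes a: "0 < a" "a \<le> 1"
  shows hurwitz_series_sums: "Re w > 1 \<Longrightarrow> (\<lambda>n. (of_nat n + of_real a) powr (- w)) sums hurwitz_series a w"
    and hurwitz_series_holomorphic: "hurwitz_series a holomorphic_on {w. Re w > 1}"
proof -
  assume "Re w > 1"
  then have "summable (\<lambda>n. a powr (- Re w) * (real n + 1) powr (- Re w))"
    by (intro summable_mult summable_Suc_powr)
  moreover have "norm ((of_nat n + complex_of_real a) powr (- w)) \<le> a powr (- Re w) * (real n + 1) powr (- Re w)" for n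
    using \<open>Re w > 1\<close> by (intro norm_shifted_powr_le a) auto
  ultimately have "summable (\<lambda>n. (of_nat n + complex_of_real a) powr (- w))"
    by (rule summable_comparison_test')
  then show "(\<lambda>n. (of_nat n + of_real a) powr (- w)) sums hurwitz_series a w"
    unfolding hurwitz_series_def by (rule summable_sums)
next
  show "hurwitz_series a holomorphic_on {w. Re w > 1}"
    unfolding hurwitz_series_def[abs_def]
  proof (rule holomorphic_on_suminf)
    show "open {w. Re w > 1}" by (rule open_halfspace_Re_gt)
    show "(\<lambda>w. (of_nat n + of_real a) powr (- w)) holomorphic_on {w. Re w > 1}" for n
    proof -
      have "of_nat n + complex_of_real a \<noteq> 0"
        using a by (auto simp: complex_eq_iff)
      then show ?thesis by (intro holomorphic_intros)
    qed
    fix w assume "w \<in> {w. Re w > 1}"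
    then have w: "Re w > 1" by simp
    define d where "d = (Re w - 1) / 2"
    have d: "d > 0" "Re w - d > 1" using w by (auto simp: d_def field_simps)
    have Re: "Re w - d \<le> Re u" "Re u \<le> Re w + d" if "u \<in> cball w d" for u
      using that abs_Re_le_cmod[of "w - u"] by (auto simp: dist_norm)
    show "\<exists>d M. d > 0 \<and> cball w d \<subseteq> {w. Re w > 1} \<and> summable M \<and>
            (\<forall>n. \<forall>u\<in>cball w d. norm ((of_nat n + complex_of_real a) powr (- u)) \<le> M n)"
    proof (intro exI conjI allI ballI)
      show "summable (\<lambda>n. a powr (- (Re w + d)) * (real n + 1) powr (- (Re w - d)))"
        using d by (intro summable_mult summable_Suc_powr)
      show "cball w d \<subseteq> {w. Re w > 1}" using Re d by force
      show "norm ((of_nat n + complex_of_real a) powr (- u))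
              \<le> a powr (- (Re w + d)) * (real n + 1) powr (- (Re w - d))" if "u \<in> cball w d" for n u
        using Re[OF that] d by (intro norm_shifted_powr_le a) auto
    qed (use d in auto)
  qed
qed

lemma cis_two_pi_neq_1:
  assumes "0 < a" "a < 1"
  shows "cis (2 * pi * a) \<noteq> 1"
proof
  assume "cis (2 * pi * a) = 1"
  then have "cos (2 * pi * a) = 1" by (simp add: complex_eq_iff)
  then obtain n :: int where "2 * pi * a = of_int n * 2 * pi" using cos_one_2pi_int by auto
  then have "a = of_int n" by simp
  with assms show False by simp
qed

lemma powr_imaginary:
  assumes "r > 0"
  shows "(of_real r * \<i>) powr (- w) = of_real r powr (- w) * exp (- (of_real pi * \<i> * w / 2))"
    and "(of_real r * - \<i>) powr (- w) = of_real r powr (- w) * exp (of_real pi * \<i> * w / 2)"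
proof -
  have "(of_real r * z) powr (- w) = of_real r powr (- w) * z powr (- w)" for z
    using assms by (intro powr_times_real_left) auto
  moreover have "\<i> powr (- w) = exp (- (of_real pi * \<i> * w / 2))"
    "(- \<i>) powr (- w) = exp (of_real pi * \<i> * w / 2)"
    by (simp_all add: powr_def mult_ac)
  ultimately show "(of_real r * \<i>) powr (- w) = of_real r powr (- w) * exp (- (of_real pi * \<i> * w / 2))"
    and "(of_real r * - \<i>) powr (- w) = of_real r powr (- w) * exp (of_real pi * \<i> * w / 2)"
    by metis+
qed

text \<open>
  Let \<open>\<mu>\<close> tend to \<open>-2 \<pi> i a\<close> in Lipschitz' formula. The left side tends to the boundary value at
  \<open>1 - w\<close> by construction. On the right the terms tend to powers of \<open>2 \<pi> i (j + 1 - a)\<close> and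
  \<open>-2 \<pi> i (j + a)\<close>; the factors \<open>i powr (-w)\<close> and \<open>(-i) powr (-w)\<close> are the two exponentials, and what
  remains are the Hurwitz series of \<open>1 - a\<close> and \<open>a\<close>.
\<close>

lemma boundary_polylog_eq_hurwitz_series:
  assumes a: "0 < a" "a < 1" and w: "Re w > 1"
  shows "boundary_polylog (cis (2 * pi * a)) (1 - w) = Gamma w * of_real (2 * pi) powr (- w) *
           (exp (of_real pi * \<i> * w / 2) * hurwitz_series a w +
            exp (- (of_real pi * \<i> * w / 2)) * hurwitz_series (1 - a) w)"
proof -
  define z where "z = cis (2 * pi * a)"
  have z: "norm z = 1" "z \<noteq> 1"
    using cis_two_pi_neq_1[OF a] by (simp_all add: z_def)
  define \<mu> where "\<mu> = (\<lambda>\<delta>::real. of_real \<delta> - 2 * of_real pi * \<i> * of_real a)"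
  have lim: "((\<lambda>\<delta>. \<Sum>j. (of_real \<delta> + of_real (2 * pi) * of_real (real j + b) * e) powr (- w))
      \<longlongrightarrow> (\<Sum>j. (of_real (2 * pi) * of_real (real j + b) * e) powr (- w))) (at_right 0)"
    if b: "0 < b" "b < 1" and e: "e = \<i> \<or> e = - \<i>" for b e
  proof -
    define r where "r = (\<lambda>j. 2 * pi * (real j + b))"
    have r: "b * (real j + 1) \<le> r j" for j
    proof -
      have "b * real j \<le> 1 * real j" using b by (intro mult_right_mono) auto
      then have "b * (real j + 1) \<le> 1 * (real j + b)" by (simp add: algebra_simps)
      also have "\<dots> \<le> 2 * pi * (real j + b)"
        using b pi_gt3 by (intro mult_right_mono) auto
      finally show ?thesis by (simp add: r_def)
    qed
    have rpos: "r j > 0" for j using b by (simp add: r_def add_nonneg_pos)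
    have Im: "\<bar>Im (of_real \<delta> + of_real (r j) * e)\<bar> = r j" for \<delta> j
      using e rpos[of j] by auto
    have "((\<lambda>\<delta>. \<Sum>j. (of_real \<delta> + of_real (r j) * e) powr (- w)) \<longlongrightarrow>
        (\<Sum>j. (of_real (r j) * e) powr (- w))) (at_right 0)"
    \<comment> \<open>The imaginary part of the base does not move with \<open>\<delta>\<close>, so it bounds the terms uniformly.\<close>
    proof (rule conjunct2[OF conjunct2[OF tannerys_theorem]])
      show "summable (\<lambda>j. exp (pi * \<bar>Im w\<bar>) * (b powr (- Re w) * (real j + 1) powr (- Re w)))"
        using w by (intro summable_mult summable_Suc_powr)
      show "\<forall>\<^sub>F (j, \<delta>) in at_top \<times>\<^sub>F at_right 0. norm ((of_real \<delta> + of_real (r j) * e) powr (- w)) \<le> 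
              exp (pi * \<bar>Im w\<bar>) * (b powr (- Re w) * (real j + 1) powr (- Re w))"
      proof (intro always_eventually allI, clarify)
        fix j \<delta>
        have "norm ((of_real \<delta> + of_real (r j) * e) powr (- w)) \<le> exp (pi * \<bar>Im w\<bar>) * (b * (real j + 1)) powr (- Re w)"
          by (rule norm_powr_le_Im) (use Im[of \<delta> j] r[of j] rpos[of j] b w in auto)
        then show "norm ((of_real \<delta> + of_real (r j) * e) powr (- w)) \<le> 
              exp (pi * \<bar>Im w\<bar>) * (b powr (- Re w) * (real j + 1) powr (- Re w))"
          using b by (simp add: powr_mult)
      qed
      fix j
      have "Im (of_real (r j) * e) \<noteq> 0" using Im[of 0 j] rpos[of j] by auto
      then have "0 + of_real (r j) * e \<notin> \<real>\<^sub>\<le>\<^sub>0" by (auto simp: complex_nonpos_Reals_iff)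
      then have "((\<lambda>\<delta>. (of_real \<delta> + of_real (r j) * e) powr (- w)) \<longlongrightarrow> (of_real 0 + of_real (r j) * e) powr (- w)) (at_right 0)"
        by (intro tendsto_intros) auto
      then show "((\<lambda>\<delta>. (of_real \<delta> + of_real (r j) * e) powr (- w)) \<longlongrightarrow> (of_real (r j) * e) powr (- w)) (at_right 0)"
        by simp
    qed simp
    then show ?thesis by (simp add: r_def mult.assoc)
  qed
  have "((\<lambda>\<delta>. polylog (1 - w) (exp (- \<mu> \<delta>))) \<longlongrightarrow> boundary_polylog z (1 - w)) (at_right 0)"
  proof (rule filterlim_compose[OF polylog_tendsto_boundary[OF z]])
    have "((\<lambda>\<delta>. exp (- \<mu> \<delta>)) \<longlongrightarrow> exp (- \<mu> 0)) (at_right 0)"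
      unfolding \<mu>_def by (intro tendsto_intros)
    moreover have "exp (- \<mu> 0) = z" by (simp add: \<mu>_def z_def cis_conv_exp mult_ac)
    moreover have "eventually (\<lambda>\<delta>. exp (- \<mu> \<delta>) \<in> ball 0 1 \<and> exp (- \<mu> \<delta>) \<noteq> z) (at_right 0)"
      unfolding eventually_at_right_field
    proof (intro exI[of _ 1] conjI allI impI)
      fix \<delta> :: real assume "0 < \<delta>"
      then have "norm (exp (- \<mu> \<delta>)) < 1" by (simp add: \<mu>_def)
      then show "exp (- \<mu> \<delta>) \<in> ball 0 1" "exp (- \<mu> \<delta>) \<noteq> z" using z by auto
    qed simp
    ultimately show "filterlim (\<lambda>\<delta>. exp (- \<mu> \<delta>)) (at z within ball 0 1) (at_right 0)"
      unfolding filterlim_at by (auto elim: eventually_mono)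
  qed
  moreover have "((\<lambda>\<delta>. polylog (1 - w) (exp (- \<mu> \<delta>))) \<longlongrightarrow> Gamma w *
      ((\<Sum>j. (of_real (2 * pi) * of_real (real j + (1 - a)) * \<i>) powr (- w)) +
       (\<Sum>j. (of_real (2 * pi) * of_real (real j + a) * - \<i>) powr (- w)))) (at_right 0)"
  proof (rule Lim_transform_eventually)
    show "((\<lambda>\<delta>. Gamma w *
      ((\<Sum>j. (of_real \<delta> + of_real (2 * pi) * of_real (real j + (1 - a)) * \<i>) powr (- w)) +
       (\<Sum>j. (of_real \<delta> + of_real (2 * pi) * of_real (real j + a) * - \<i>) powr (- w)))) \<longlongrightarrow> Gamma w *
      ((\<Sum>j. (of_real (2 * pi) * of_real (real j + (1 - a)) * \<i>) powr (- w)) +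
       (\<Sum>j. (of_real (2 * pi) * of_real (real j + a) * - \<i>) powr (- w)))) (at_right 0)"
      using a by (intro tendsto_intros lim) auto
    show "\<forall>\<^sub>F \<delta> in at_right 0. Gamma w *
      ((\<Sum>j. (of_real \<delta> + of_real (2 * pi) * of_real (real j + (1 - a)) * \<i>) powr (- w)) +
       (\<Sum>j. (of_real \<delta> + of_real (2 * pi) * of_real (real j + a) * - \<i>) powr (- w))) =
       polylog (1 - w) (exp (- \<mu> \<delta>))"
      unfolding eventually_at_right_field
    proof (intro exI[of _ 1] conjI allI impI)
      fix \<delta> :: real assume "0 < \<delta>"
      have eq: "of_real \<delta> + of_real (2 * pi) * of_real (real j + (1 - a)) * \<i> = \<mu> \<delta> + 2 * of_real pi * \<i> * of_nat (Suc j)"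
        "of_real \<delta> + of_real (2 * pi) * of_real (real j + a) * - \<i> = \<mu> \<delta> - 2 * of_real pi * \<i> * of_nat j" for j
        by (simp_all add: \<mu>_def algebra_simps)
      show "Gamma w *
      ((\<Sum>j. (of_real \<delta> + of_real (2 * pi) * of_real (real j + (1 - a)) * \<i>) powr (- w)) +
       (\<Sum>j. (of_real \<delta> + of_real (2 * pi) * of_real (real j + a) * - \<i>) powr (- w))) =
       polylog (1 - w) (exp (- \<mu> \<delta>))"
        unfolding eq using \<open>0 < \<delta>\<close> w a
        by (intro lipschitz_formula[symmetric, where a = a]) (auto simp: \<mu>_def)
    qed simp
  qed
  moreover have series: "(\<Sum>j. (of_real (2 * pi) * of_real (real j + b) * e) powr (- w)) =
     of_real (2 * pi) powr (- w) * q * hurwitz_series b w"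
    if b: "0 < b" "b < 1" and e: "\<And>r. r > 0 \<Longrightarrow> (of_real r * e) powr (- w) = of_real r powr (- w) * q" for b e q
  proof -
    have "(of_real (2 * pi) * of_real (real j + b) * e) powr (- w) =
        of_real (2 * pi) powr (- w) * q * (of_nat j + of_real b) powr (- w)" for j
    proof -
      have pos: "real j + b > 0" using b by simp
      have "(of_real (2 * pi) * of_real (real j + b) * e) powr (- w) = of_real (2 * pi * (real j + b)) powr (- w) * q"
        using e[of "2 * pi * (real j + b)"] pos by simp
      also have "complex_of_real (2 * pi * (real j + b)) powr (- w) =
          of_real (2 * pi) powr (- w) * of_real (real j + b) powr (- w)"
        unfolding of_real_mult[of "2 * pi"] using pos by (intro powr_times_real) auto
      finally show ?thesis by simp
    qed
    then show ?thesis
      using hurwitz_series_sums[of b w] b w by (simp add: suminf_mult sums_iff)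
  qed
  ultimately have "boundary_polylog z (1 - w) = Gamma w *
      ((\<Sum>j. (of_real (2 * pi) * of_real (real j + (1 - a)) * \<i>) powr (- w)) +
       (\<Sum>j. (of_real (2 * pi) * of_real (real j + a) * - \<i>) powr (- w)))"
    by (intro tendsto_unique[OF trivial_limit_at_right_real])
  also have "(\<Sum>j. (of_real (2 * pi) * of_real (real j + (1 - a)) * \<i>) powr (- w)) =
     of_real (2 * pi) powr (- w) * exp (- (of_real pi * \<i> * w / 2)) * hurwitz_series (1 - a) w"
    by (rule series) (use a powr_imaginary(1) in auto)
  also have "(\<Sum>j. (of_real (2 * pi) * of_real (real j + a) * - \<i>) powr (- w)) =
     of_real (2 * pi) powr (- w) * exp (of_real pi * \<i> * w / 2) * hurwitz_series a w"
    by (rule series) (use a powr_imaginary(2) in auto)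
  finally show ?thesis by (simp add: z_def algebra_simps)
qed

section \<open>Analytic continuation and Hurwitz' formula\<close>

text \<open>
  \<open>boundary_polylog_eq_hurwitz_series\<close>, for \<open>a\<close> and for \<open>1 - a\<close>, is a linear system for the two Hurwitz
  series; apart from the scalar in front its determinant is \<open>2 i sin (\<pi> w)\<close>. This is its solution for \<open>a\<close>, with
  \<open>1 / (Gamma w sin (\<pi> w))\<close> rewritten as \<open>Gamma (1 - w) / \<pi>\<close>. The boundary values being entire, it
  makes sense for all \<open>w\<close> but the poles \<open>1, 2, 3, \<dots>\<close> of \<open>Gamma (1 - w)\<close>.
\<close>

definition hurwitz_continuation :: "real \<Rightarrow> complex \<Rightarrow> complex" where
  "hurwitz_continuation a w = of_real (2 * pi) powr w * Gamma (1 - w) / (2 * of_real pi * \<i>) *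
     (exp (of_real pi * \<i> * w / 2) * boundary_polylog (cis (2 * pi * a)) (1 - w) -
      exp (- (of_real pi * \<i> * w / 2)) * boundary_polylog (cis (2 * pi * (1 - a))) (1 - w))"

lemma hurwitz_continuation_eq_series:
  assumes a: "0 < a" "a < 1" and w: "Re w > 1" "w \<notin> \<int>"
  shows "hurwitz_continuation a w = hurwitz_series a w"
proof -
  define p where "p = exp (of_real pi * \<i> * w / 2)"
  have p: "exp (- (of_real pi * \<i> * w / 2)) = inverse p" "p \<noteq> 0"
    by (simp_all add: p_def exp_minus)
  have sin: "p * p - inverse p * inverse p = 2 * \<i> * sin (of_real pi * w)"
  proof -
    have "p * p = exp (\<i> * (of_real pi * w))" "inverse p * inverse p = exp (- \<i> * (of_real pi * w))"
      unfolding p_def by (simp_all add: mult_exp_exp flip: exp_minus) (simp_all add: mult_ac)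
    then show ?thesis by (simp add: sin_exp_eq field_simps)
  qed
  have s: "sin (of_real pi * w) \<noteq> 0"
    using w(2) by (auto simp: sin_eq_0 elim!: Ints_cases)
  have refl: "Gamma w * Gamma (1 - w) * sin (of_real pi * w) = of_real pi"
    using Gamma_reflection_complex[of w] s by (simp add: field_simps)
  have pw: "of_real (2 * pi) powr w * of_real (2 * pi) powr (- w) = (1 :: complex)"
    by (simp add: powr_minus)
  let ?A = "hurwitz_series a w" and ?B = "hurwitz_series (1 - a) w"
  define k where "k = Gamma w * of_real (2 * pi) powr (- w)"
  have E: "boundary_polylog (cis (2 * pi * a)) (1 - w) = k * (p * ?A + inverse p * ?B)"
    "boundary_polylog (cis (2 * pi * (1 - a))) (1 - w) = k * (p * ?B + inverse p * ?A)"
    using boundary_polylog_eq_hurwitz_series[of a w]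
      boundary_polylog_eq_hurwitz_series[of "1 - a" w] a w
    by (simp_all add: k_def p_def exp_minus)
  have "p * (k * (p * ?A + inverse p * ?B)) - inverse p * (k * (p * ?B + inverse p * ?A))
     = k * ((p * p - inverse p * inverse p) * ?A)"
    using p(2) by (simp add: algebra_simps)
  also have "\<dots> = k * (2 * \<i> * sin (of_real pi * w)) * ?A" by (simp only: sin mult.assoc)
  finally have "hurwitz_continuation a w = of_real (2 * pi) powr w * Gamma (1 - w) / (2 * of_real pi * \<i>) *
      (k * (2 * \<i> * sin (of_real pi * w)) * ?A)"
    unfolding hurwitz_continuation_def p_def[symmetric] p(1) E by simp
  also have "\<dots> = (of_real (2 * pi) powr w * of_real (2 * pi) powr (- w)) *
      (Gamma w * Gamma (1 - w) * sin (of_real pi * w)) / of_real pi * ?A"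
    by (simp add: k_def)
  also have "\<dots> = ?A" unfolding pw refl by simp
  finally show ?thesis .
qed

text \<open>
  At \<open>w = 2, 3, \<dots>\<close> the continuation formula has removable singularities, but there the series
  is available; the two domains cover everything except the pole at \<open>1\<close>.
\<close>

lemma is_hurwitz_zeta_continuation:
  assumes a: "0 < a" "a < 1"
  shows "is_hurwitz_zeta a (\<lambda>w. if Re w > 1 then hurwitz_series a w else hurwitz_continuation a w)"
    (is "is_hurwitz_zeta a ?Z")
  unfolding is_hurwitz_zeta_def
proof (intro conjI allI impI)
  \<comment> \<open>\<open>U\<close> is the set where \<open>Gamma (1 - w)\<close> has no pole.\<close>
  define U where "U = - ((\<lambda>n. of_int n) ` {1..} :: complex set)"
  have "closed ((\<lambda>n. of_int n) ` {1..} :: complex set)"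
    by (rule closed_of_int_image)
  then have U: "open U" by (simp add: U_def open_Compl)
  have "?Z holomorphic_on {w. Re w > 1}"
    using hurwitz_series_holomorphic[of a] a
    by (subst holomorphic_cong[OF refl, of _ _ "hurwitz_series a"]) auto
  moreover have "?Z holomorphic_on U"
  proof -
    have np: "1 - w \<notin> \<int>\<^sub>\<le>\<^sub>0" if "w \<in> U" for w
    proof
      assume "1 - w \<in> \<int>\<^sub>\<le>\<^sub>0"
      then obtain n :: int where n: "n \<le> 0" "1 - w = of_int n" by (auto elim: nonpos_Ints_cases)
      then have "w = of_int (1 - n)" by (simp add: algebra_simps)
      moreover have "1 - n \<in> {1..}" using n by simp
      ultimately have "w \<notin> U" unfolding U_def by blast
      with that show False by simp
    qed
    have hol: "(\<lambda>w. boundary_polylog (cis (2 * pi * b)) (1 - w)) holomorphic_on U" if "0 < b" "b < 1" for b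
    proof -
      have 1: "(\<lambda>w. 1 - w) holomorphic_on U" by (intro holomorphic_intros)
      have 2: "boundary_polylog (cis (2 * pi * b)) holomorphic_on (\<lambda>w. 1 - w) ` U"
        using cis_two_pi_neq_1[OF that] by (intro boundary_polylog_holomorphic) auto
      show ?thesis using holomorphic_on_compose[OF 1 2] by (simp add: o_def)
    qed
    have "hurwitz_continuation a holomorphic_on U"
      unfolding hurwitz_continuation_def[abs_def] using a
      by (intro holomorphic_intros hol) (use np in auto)
    moreover have "hurwitz_continuation a w = ?Z w" if "w \<in> U" for w
    proof (cases "Re w > 1")
      case True
      have "w \<notin> \<int>"
      proof
        assume "w \<in> \<int>"
        then obtain n :: int where "w = of_int n" by (auto elim: Ints_cases)
        with that True show False by (auto simp: U_def)
      qed
      with True a show ?thesis by (simp add: hurwitz_continuation_eq_series)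
    qed simp
    ultimately show ?thesis by (subst holomorphic_cong[OF refl, of _ _ "hurwitz_continuation a"]) auto
  qed
  ultimately have "?Z holomorphic_on ({w. Re w > 1} \<union> U)"
    using U by (intro holomorphic_on_Un open_halfspace_Re_gt)
  moreover have "- {1} \<subseteq> {w. Re w > 1} \<union> U"
  proof
    fix w :: complex assume "w \<in> - {1}"
    show "w \<in> {w. Re w > 1} \<union> U"
    proof (cases "w \<in> U")
      case False
      then obtain n :: int where "n \<ge> 1" "w = of_int n" by (auto simp: U_def)
      with \<open>w \<in> - {1}\<close> show ?thesis by (cases "n = 1") auto
    qed simp
  qed
  ultimately show "?Z holomorphic_on - {1}" by (rule holomorphic_on_subset)
next
  fix w :: complex assume "Re w > 1"
  then show "(\<lambda>n. (of_nat n + of_real a) powr (- w)) sums ?Z w"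
    using hurwitz_series_sums[of a w] a by simp
qed

lemma hurwitz_zeta_eq:
  assumes a: "0 < a" "a < 1" and w: "Re w \<le> 1" "w \<noteq> 1"
  shows "hurwitz_zeta w a = hurwitz_continuation a w"
proof -
  have "is_hurwitz_zeta a (SOME f. is_hurwitz_zeta a f)"
    by (rule someI[of "is_hurwitz_zeta a", OF is_hurwitz_zeta_continuation[OF a]])
  from is_hurwitz_zeta_unique[OF this is_hurwitz_zeta_continuation[OF a] w(2)]
  show ?thesis using w by (simp add: hurwitz_zeta_def)
qed

text \<open>
  For \<open>Re s > 1\<close> the point \<open>1 - s\<close> lies in the region of the continuation formula, and the boundary
  values at \<open>s\<close> are ordinary convergent series. The factor
  \<open>exp (\<pi> i / 2) = i\<close> split off by \<open>w = 1 - s\<close> turns the difference into a sum.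
\<close>

theorem hurwitz_formula:
  assumes a: "0 < a" "a < 1" and s: "Re s > 1"
  shows "hurwitz_zeta (1 - s) a = Gamma s * of_real (2 * pi) powr (- s) *
           (exp (- (of_real pi * \<i> * s / 2)) * polylog s (cis (2 * pi * a)) +
            exp (of_real pi * \<i> * s / 2) * polylog s (cis (2 * pi * (1 - a))))"
proof -
  have e: "exp (of_real pi * \<i> * (1 - s) / 2) = \<i> * exp (- (of_real pi * \<i> * s / 2))"
    "exp (- (of_real pi * \<i> * (1 - s) / 2)) = - \<i> * exp (of_real pi * \<i> * s / 2)"
  proof -
    have i: "exp (of_real pi * \<i> / 2) = \<i>"
      using cis_conv_exp[of "pi / 2"] by (simp add: mult_ac)
    have 1: "of_real pi * \<i> * (1 - s) / 2 = of_real pi * \<i> / 2 + - (of_real pi * \<i> * s / 2)"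
      by (simp add: field_simps)
    have 2: "- (of_real pi * \<i> * (1 - s) / 2) = - (of_real pi * \<i> / 2) + of_real pi * \<i> * s / 2"
      by (simp add: field_simps)
    show "exp (of_real pi * \<i> * (1 - s) / 2) = \<i> * exp (- (of_real pi * \<i> * s / 2))"
      unfolding 1 exp_add i ..
    show "exp (- (of_real pi * \<i> * (1 - s) / 2)) = - \<i> * exp (of_real pi * \<i> * s / 2)"
      unfolding 2 exp_add exp_minus[of "of_real pi * \<i> / 2"] i by simp
  qed
  have "hurwitz_zeta (1 - s) a = hurwitz_continuation a (1 - s)"
    using a s by (intro hurwitz_zeta_eq) auto
  also have "\<dots> = of_real (2 * pi) powr (1 - s) * Gamma s / (2 * of_real pi * \<i>) *
     (\<i> * exp (- (of_real pi * \<i> * s / 2)) * polylog s (cis (2 * pi * a)) -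
      - \<i> * exp (of_real pi * \<i> * s / 2) * polylog s (cis (2 * pi * (1 - a))))"
    using cis_two_pi_neq_1[of a] cis_two_pi_neq_1[of "1 - a"] a s
    by (simp add: hurwitz_continuation_def e boundary_polylog_eq)
  also have "of_real (2 * pi) powr (1 - s) = of_real (2 * pi) * of_real (2 * pi) powr (- s)"
    by (simp add: powr_diff powr_minus field_simps)
  finally show ?thesis by (simp add: field_simps)
qed

section \<open>The trigonometric series\<close>

lemma sums_polylog:
  assumes "norm q \<le> 1" "Re s > 1"
  shows "(\<lambda>n. of_nat (Suc n) powr (- s) * q ^ Suc n) sums polylog s q"
proof -
  have "summable (\<lambda>n. of_nat (Suc n) powr (- s) * q ^ Suc n)"
  proof (rule summable_comparison_test'[OF summable_Suc_powr[OF assms(2)]])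
    fix n :: nat
    have "norm (of_nat (Suc n) powr (- s) * q ^ Suc n) = real (Suc n) powr (- Re s) * norm q ^ Suc n"
      by (simp add: norm_mult norm_power norm_powr_real_powr del: of_nat_Suc power_Suc)
    also have "\<dots> \<le> real (Suc n) powr (- Re s) * 1"
      using assms by (intro mult_left_mono power_le_one) auto
    finally show "norm (of_nat (Suc n) powr (- s) * q ^ Suc n) \<le> (real n + 1) powr (- Re s)"
      by (simp add: add.commute)
  qed
  then show ?thesis unfolding polylog_def by (rule summable_sums)
qed

text \<open>
  Substituting Hurwitz' formula, the right-hand sides are combinations of the values of the
  polylogarithm at \<open>exp (i x)\<close> and \<open>exp (-i x)\<close>. In terms of \<open>p = exp (i y)\<close> and
  \<open>q = exp (\<pi> i s / 2)\<close> all trigonometric factors are Laurent polynomials, the mixed terms cancel, and a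
  common factor \<open>sin (\<pi> s)\<close> remains, cancelled by the one in the denominator.
\<close>

theorem theorem1p1:
  fixes s :: complex and x y :: real
  assumes "Re s > 1" and "s \<notin> \<int>" and "0 < x" and "x < 2 * pi"
  shows "(\<lambda>n. of_real (sin (real (Suc n) * x + y)) / of_nat (Suc n) powr s) sums
           (of_real (2 * pi) powr s / (2 * Gamma s * sin (of_real pi * s)) *
             (cos (of_real y - of_real pi * s / 2) * hurwitz_zeta (1 - s) (x / (2 * pi)) -
              cos (of_real y + of_real pi * s / 2) * hurwitz_zeta (1 - s) (1 - x / (2 * pi)))) \<and>
         (\<lambda>n. of_real (cos (real (Suc n) * x + y)) / of_nat (Suc n) powr s) sums
           (of_real (2 * pi) powr s / (2 * Gamma s * sin (of_real pi * s)) *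
             (sin (of_real y + of_real pi * s / 2) * hurwitz_zeta (1 - s) (1 - x / (2 * pi)) -
              sin (of_real y - of_real pi * s / 2) * hurwitz_zeta (1 - s) (x / (2 * pi))))"
proof -
  define a where "a = x / (2 * pi)"
  have a: "0 < a" "a < 1" using assms by (simp_all add: a_def)
  have x: "x = 2 * pi * a" by (simp add: a_def)
  define A where "A = polylog s (cis x)"
  define B where "B = polylog s (cis (- x))"
  define p where "p = exp (\<i> * of_real y)"
  define q where "q = exp (of_real pi * \<i> * s / 2)"
  define k where "k = Gamma s * of_real (2 * pi) powr (- s)"
  have nz: "p \<noteq> 0" "q \<noteq> 0" by (simp_all add: p_def q_def)
  have sin: "sin (of_real pi * s) \<noteq> 0"
    using assms(2) by (auto simp: sin_eq_0 elim!: Ints_cases)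
  have G: "Gamma s \<noteq> 0"
    using assms(1) by (auto simp: Gamma_eq_zero_iff elim!: nonpos_Ints_cases)
  have "2 * pi * (1 - a) = 2 * pi + - x" by (simp add: x algebra_simps)
  then have "cis (2 * pi * (1 - a)) = cis (- x)"
    by (simp only: cis_mult[symmetric] cis_2pi mult_1)
  then have zeta: "hurwitz_zeta (1 - s) (x / (2 * pi)) = k * (inverse q * A + q * B)"
    "hurwitz_zeta (1 - s) (1 - x / (2 * pi)) = k * (inverse q * B + q * A)"
    using hurwitz_formula[of a s] hurwitz_formula[of "1 - a" s] a assms(1)
    by (simp_all add: A_def B_def k_def q_def exp_minus flip: a_def x)
  have trig: "cos (of_real y - of_real pi * s / 2) = (p / q + q / p) / 2"
    "cos (of_real y + of_real pi * s / 2) = (p * q + 1 / (p * q)) / 2"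
    "sin (of_real y - of_real pi * s / 2) = (p / q - q / p) / (2 * \<i>)"
    "sin (of_real y + of_real pi * s / 2) = (p * q - 1 / (p * q)) / (2 * \<i>)"
    "sin (of_real pi * s) = (q * q - 1 / (q * q)) / (2 * \<i>)"
  proof -
    have arg: "\<i> * (of_real y - of_real pi * s / 2) = \<i> * of_real y - of_real pi * \<i> * s / 2"
      "\<i> * (of_real y + of_real pi * s / 2) = \<i> * of_real y + of_real pi * \<i> * s / 2"
      "\<i> * (of_real pi * s) = of_real pi * \<i> * s / 2 + of_real pi * \<i> * s / 2"
      by (simp_all add: field_simps)
    have 1: "exp (\<i> * (of_real y - of_real pi * s / 2)) = p / q"
      "exp (- (\<i> * (of_real y - of_real pi * s / 2))) = q / p"
      "exp (\<i> * (of_real y + of_real pi * s / 2)) = p * q"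
      "exp (- (\<i> * (of_real y + of_real pi * s / 2))) = 1 / (p * q)"
      "exp (\<i> * (of_real pi * s)) = q * q"
      "exp (- (\<i> * (of_real pi * s))) = 1 / (q * q)"
      unfolding arg p_def q_def exp_minus exp_add exp_diff by (simp_all add: inverse_eq_divide)
    show "cos (of_real y - of_real pi * s / 2) = (p / q + q / p) / 2"
      "cos (of_real y + of_real pi * s / 2) = (p * q + 1 / (p * q)) / 2"
      "sin (of_real y - of_real pi * s / 2) = (p / q - q / p) / (2 * \<i>)"
      "sin (of_real y + of_real pi * s / 2) = (p * q - 1 / (p * q)) / (2 * \<i>)"
      "sin (of_real pi * s) = (q * q - 1 / (q * q)) / (2 * \<i>)"
      unfolding cos_exp_eq sin_exp_eq 1 by simp_all
  qed
  have A: "(\<lambda>n. of_nat (Suc n) powr (- s) * cis x ^ Suc n) sums A"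
    and B: "(\<lambda>n. of_nat (Suc n) powr (- s) * cis (- x) ^ Suc n) sums B"
    unfolding A_def B_def using assms(1) by (simp_all only: sums_polylog norm_cis order_refl)
  have cis: "p * cis x ^ Suc n = cis (real (Suc n) * x + y)"
    "inverse p * cis (- x) ^ Suc n = cis (- (real (Suc n) * x + y))" for n
  proof -
    have P: "p = cis y" "inverse p = cis (- y)" by (simp_all add: p_def cis_conv_exp exp_minus)
    show "p * cis x ^ Suc n = cis (real (Suc n) * x + y)"
      unfolding P(1) Complex.DeMoivre cis_mult by (simp add: add.commute)
    show "inverse p * cis (- x) ^ Suc n = cis (- (real (Suc n) * x + y))"
      unfolding P(2) Complex.DeMoivre cis_mult by (simp add: algebra_simps)
  qed
  have k: "of_real (2 * pi) powr s / (2 * Gamma s * sin (of_real pi * s)) * (k * u) = u / (2 * sin (of_real pi * s))" for u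
  proof -
    have "of_real (2 * pi) powr s * of_real (2 * pi) powr (- s) = (1 :: complex)"
      by (simp add: powr_minus)
    then show ?thesis unfolding k_def using G by (simp add: field_simps)
  qed
  have "(\<lambda>n. of_real (sin (real (Suc n) * x + y)) / of_nat (Suc n) powr s) sums ((p * A - inverse p * B) / (2 * \<i>))"
  proof -
    have euler: "complex_of_real (sin t) = (cis t - cis (- t)) / (2 * \<i>)" for t
      by (simp add: complex_eq_iff)
    have factor: "(u - v) / (2 * \<i>) / N powr s = (N powr (- s) * u - N powr (- s) * v) / (2 * \<i>)" for u v N :: complex
      unfolding powr_minus divide_inverse by (simp only: ring_distribs mult_ac)
    have "of_real (sin (real (Suc n) * x + y)) / of_nat (Suc n) powr s =
      (p * (of_nat (Suc n) powr (- s) * cis x ^ Suc n) - inverse p * (of_nat (Suc n) powr (- s) * cis (- x) ^ Suc n)) / (2 * \<i>)" for n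
      unfolding mult.left_commute[of p] mult.left_commute[of "inverse p"] cis euler by (rule factor)
    then show ?thesis
      using sums_divide[OF sums_diff[OF sums_mult[OF A, of p] sums_mult[OF B, of "inverse p"]], of "2 * \<i>"]
      by simp
  qed
  moreover have "(p * A - inverse p * B) / (2 * \<i>) =
     of_real (2 * pi) powr s / (2 * Gamma s * sin (of_real pi * s)) *
             (cos (of_real y - of_real pi * s / 2) * hurwitz_zeta (1 - s) (x / (2 * pi)) -
              cos (of_real y + of_real pi * s / 2) * hurwitz_zeta (1 - s) (1 - x / (2 * pi)))"
  proof -
    have "cos (of_real y - of_real pi * s / 2) * hurwitz_zeta (1 - s) (x / (2 * pi)) -
       cos (of_real y + of_real pi * s / 2) * hurwitz_zeta (1 - s) (1 - x / (2 * pi)) =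
       k * ((1 / (q * q) - q * q) / 2 * (p * A - inverse p * B))" (is "?L = _")
      unfolding zeta trig using nz by (simp add: field_simps)
    also have "(1 / (q * q) - q * q) / 2 = - \<i> * sin (of_real pi * s)"
      unfolding trig by (simp add: field_simps)
    finally have L: "?L = k * (- \<i> * sin (of_real pi * s) * (p * A - inverse p * B))" .
    have "u / (2 * \<i>) = - \<i> * S * u / (2 * S)" if "S \<noteq> 0" for u S :: complex
      using that by (simp add: field_simps)
    from this[OF sin] show ?thesis unfolding L k .
  qed
  moreover have "(\<lambda>n. of_real (cos (real (Suc n) * x + y)) / of_nat (Suc n) powr s) sums ((p * A + inverse p * B) / 2)"
  proof -
    have euler: "complex_of_real (cos t) = (cis t + cis (- t)) / 2" for t
      by (simp add: complex_eq_iff)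
    have factor: "(u + v) / 2 / N powr s = (N powr (- s) * u + N powr (- s) * v) / 2" for u v N :: complex
      unfolding powr_minus divide_inverse by (simp only: ring_distribs mult_ac)
    have "of_real (cos (real (Suc n) * x + y)) / of_nat (Suc n) powr s =
      (p * (of_nat (Suc n) powr (- s) * cis x ^ Suc n) + inverse p * (of_nat (Suc n) powr (- s) * cis (- x) ^ Suc n)) / 2" for n
      unfolding mult.left_commute[of p] mult.left_commute[of "inverse p"] cis euler by (rule factor)
    then show ?thesis
      using sums_divide[OF sums_add[OF sums_mult[OF A, of p] sums_mult[OF B, of "inverse p"]], of 2]
      by (simp only:)
  qed
  moreover have "(p * A + inverse p * B) / 2 =
     of_real (2 * pi) powr s / (2 * Gamma s * sin (of_real pi * s)) *
             (sin (of_real y + of_real pi * s / 2) * hurwitz_zeta (1 - s) (1 - x / (2 * pi)) -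
              sin (of_real y - of_real pi * s / 2) * hurwitz_zeta (1 - s) (x / (2 * pi)))"
  proof -
    have "sin (of_real y + of_real pi * s / 2) * hurwitz_zeta (1 - s) (1 - x / (2 * pi)) -
              sin (of_real y - of_real pi * s / 2) * hurwitz_zeta (1 - s) (x / (2 * pi)) =
       k * ((q * q - 1 / (q * q)) / (2 * \<i>) * (p * A + inverse p * B))" (is "?L = _")
      unfolding zeta trig using nz by (simp add: field_simps)
    also have "(q * q - 1 / (q * q)) / (2 * \<i>) = sin (of_real pi * s)"
      unfolding trig ..
    finally have L: "?L = k * (sin (of_real pi * s) * (p * A + inverse p * B))" .
    have "u / 2 = S * u / (2 * S)" if "S \<noteq> 0" for u S :: complex
      using that by simp
    from this[OF sin] show ?thesis unfolding L k .
  qed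
  ultimately show ?thesis by simp
qed

end
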